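(* Let $\lambda_n\in\Pi(T_n)$ ($n\in\mathbb{N}$) be such that $\lim_{n\to\infty}\lambda_n=\lambda$ for some non-zero $\lambda\in\mathbb{C}$. Consider the conditions: (A) the sequence $\{\boldsymbol{t}_{n|\lambda_n}(s)\}_{n=1}^\infty$ is relatively compact in $L^2$ for each fixed $s\in\mathbb{R}$; (B) the sequence $\{\boldsymbol{t}'_{n|\lambda_n}(t)\}_{n=1}^\infty$ is relatively compact in $L^2$ for each fixed $t\in\mathbb{R}$. Then the following assertions are true. (1) If (A) holds, then $\lambda\notin\Lambda_p(T)$. (2) If (B) holds, then $\lambda\notin\Lambda_r(T)$. (3) If both (A) and (B) hold, then: (a) the sequence $\{\boldsymbol{T}_{n|\lambda_n}\}$ has a pointwise limit $\boldsymbol{R}$: $\boldsymbol{R}(s,t)=\lim_{n\to\infty}\boldsymbol{T}_{n|\lambda_n}(s,t)$ for every $(s,t)\in\mathbb{R}^2$; (b) for $g\in L^2$, the integral equation of the second kind $$f(s)-\lambda\int\boldsymbol{T}(s,t)f(t)\,dt=g(s)\quad\text{for almost every }s\in\mathbb{R}$$ is solvable in $f\in L^2$ if and only if both $$\int\left|\int\boldsymbol{R}(s,t)g(t)\,dt\right|^2ds<\infty$$ and $$\int\boldsymbol{T}(s,x)\int\boldsymbol{R}(x,t)g(t)\,dt\,dx=\int g(t)\int\boldsymbol{T}(s,x)\boldsymbol{R}(x,t)\,dx\,dt\quad\text{for every }s\in\mathbb{R},$$ and in that case the equation has a unique solution $f\in L^2$, given by $$f(s)=g(s)+\lambda\int\boldsymbol{R}(s,t)g(t)\,dt\quad\text{for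 almost every }s\in\mathbb{R}.$$
   Context: $L^2=L^2(\mathbb{R})$ is the complex Hilbert space with inner product $\langle f,g\rangle=\int f(s)\overline{g(s)}\,ds$ (integrals without indicated domain are over $\mathbb{R}$, Lebesgue measure) and norm $\|\cdot\|$; $\mathfrak{R}(L^2)$ is the algebra of bounded linear operators $L^2\to L^2$. For a Banach space $B$ and $k\in\mathbb{N}$, $C(\mathbb{R}^k,B)$ is the Banach space, with the sup-norm, of continuous functions $f:\mathbb{R}^k\to B$ with $\|f(x)\|_B\to0$ as $|x|\to\infty$. A sequence in a normed space $Y$ is relatively compact if every sequence of elements of its set of values contains a subsequence converging in the norm of $Y$. $K^0$-kernels: a measurable function $\boldsymbol{K}:\mathbb{R}^2\to\mathbb{C}$, square integrable in each variable for almost every value of the other, is a $K^0$-kernel if (i) $\boldsymbol{K}\in C(\mathbb{R}^2,\mathbb{C})$; (ii) the Carleman function $\boldsymbol{k}(s)=\overline{\boldsymbol{K}(s,\cdot)}$ is in $C(\mathbb{R},L^2)$; (iii) the Carleman function $\boldsymbol{k}'(s)=\boldsymbol{K}(\cdot,s)$ is in $C(\mathbb{R},L^2)$. A kernel $\boldsymbol{K}$ induces (is the kernel of) $K\in\mathfrak{R}(L^2)$ if $(Kf)(s)=\int\boldsymbol{K}(s,t)f(t)\,dt$ for every $f\in L^2$ and almost every $s$. Standing assumptions: $\boldsymbol{T}$ is a $K^0$-kernel inducing an operator $T\in\mathfrak{R}(L^2)$, and there are positive reals $\tau_n$ ($n\in\mathbb{N}$), strictly increasing to $\infty$, such that, with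 $\chi_n$ the characteristic function of $(-\tau_n,\tau_n)$ and $P_nf=\chi_nf$, for each $n$ the subkernels $\boldsymbol{T}_n(s,t)=\chi_n(s)\boldsymbol{T}(s,t)$ and $\widetilde{\boldsymbol{T}}_n(s,t)=\chi_n(s)\boldsymbol{T}(s,t)\chi_n(t)$ are $K^0$-kernels and the operators they induce, $T_n=P_nT$ and $\widetilde{T}_n=P_nTP_n$, are nuclear. For $S\in\mathfrak{R}(L^2)$, $\Pi(S)$ (regular values) is the set of $\lambda\in\mathbb{C}$ for which $I-\lambda S$ has an inverse in $\mathfrak{R}(L^2)$; for $\lambda\in\Pi(S)$ the Fredholm resolvent is $S_{|\lambda}=S(I-\lambda S)^{-1}$. If $S$ is induced by a $K^0$-kernel $\boldsymbol{S}$ and $\lambda\in\Pi(S)$, the resolvent kernel $\boldsymbol{S}_{|\lambda}$ is the (existing and unique) $K^0$-kernel inducing $S_{|\lambda}$; the resolvent Carleman functions are $\boldsymbol{s}_{|\lambda}(s)=\overline{\boldsymbol{S}_{|\lambda}(s,\cdot)}$ and $\boldsymbol{s}'_{|\lambda}(t)=\boldsymbol{S}_{|\lambda}(\cdot,t)$. In particular $\boldsymbol{T}_{n|\lambda}$ is the resolvent kernel for $\boldsymbol{T}_n$ at $\lambda$, with $\boldsymbol{t}_{n|\lambda}(s)=\overline{\boldsymbol{T}_{n|\lambda}(s,\cdot)}$ and $\boldsymbol{t}'_{n|\lambda}(t)=\boldsymbol{T}_{n|\lambda}(\cdot,t)$. The characteristic set of $T$ is $\Lambda(T)=\mathbb{C}\setminus\Pi(T)$,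 with $\Lambda_p(T)=\{\lambda\in\Lambda(T):\operatorname{Ker}(I-\lambda T)\ne\{0\}\}$ and $\Lambda_r(T)=\{\lambda\in\Lambda(T):\operatorname{Ker}(I-\lambda T)=\{0\},\ \overline{\operatorname{Ran}(I-\lambda T)}\ne L^2\}$. *)

theory Defs
  imports "HOL-Analysis.Analysis"
begin

subsection \<open>The complex Hilbert space $L^2(\mathbf{R})$\<close>

definition square_integrable :: "(real \<Rightarrow> complex) \<Rightarrow> bool" where
  "square_integrable f \<longleftrightarrow>
     f \<in> borel_measurable lebesgue \<and> integrable lebesgue (\<lambda>x. (cmod (f x))\<^sup>2)"

lemma square_integrable_mult_cnj:
  assumes "square_integrable f" "square_integrable g"
  shows "integrable lebesgue (\<lambda>x. f x * cnj (g x))"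
proof (rule Bochner_Integration.integrable_bound)
  show "integrable lebesgue (\<lambda>x. (cmod (f x))\<^sup>2 + (cmod (g x))\<^sup>2)"
    using assms by (auto simp: square_integrable_def)
  have [measurable]: "f \<in> borel_measurable lebesgue" "g \<in> borel_measurable lebesgue"
    using assms by (auto simp: square_integrable_def)
  have "(\<lambda>x. cnj (g x)) \<in> borel_measurable lebesgue"
    by (rule borel_measurable_continuous_on[of cnj]) (auto intro: continuous_intros)
  then show "(\<lambda>x. f x * cnj (g x)) \<in> borel_measurable lebesgue" by simp
  have "a * b \<le> a\<^sup>2 + b\<^sup>2" if "a \<ge> 0" "b \<ge> 0" for a b :: real
    using that sum_squares_bound[of a b] mult_nonneg_nonneg[OF that] by linarith
  then show "AE x in lebesgue. norm (f x * cnj (g x)) \<le> norm ((cmod (f x))\<^sup>2 + (cmod (g x))\<^sup>2)"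
    by (intro AE_I2) (simp add: norm_mult)
qed

lemma square_integrable_add:
  assumes "square_integrable f" "square_integrable g"
  shows "square_integrable (\<lambda>x. f x + g x)"
  unfolding square_integrable_def
proof (intro conjI)
  have [measurable]: "f \<in> borel_measurable lebesgue" "g \<in> borel_measurable lebesgue"
    using assms by (auto simp: square_integrable_def)
  show "(\<lambda>x. f x + g x) \<in> borel_measurable lebesgue" by simp
  show "integrable lebesgue (\<lambda>x. (cmod (f x + g x))\<^sup>2)"
  proof (rule Bochner_Integration.integrable_bound)
    show "integrable lebesgue (\<lambda>x. 2 * (cmod (f x))\<^sup>2 + 2 * (cmod (g x))\<^sup>2)"
      using assms by (auto simp: square_integrable_def)
    have "(cmod (a + b))\<^sup>2 \<le> 2 * (cmod a)\<^sup>2 + 2 * (cmod b)\<^sup>2" for a b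
    proof -
      have "(cmod (a + b))\<^sup>2 \<le> (cmod a + cmod b)\<^sup>2"
        by (intro power_mono norm_triangle_ineq norm_ge_zero)
      also have "\<dots> \<le> 2 * (cmod a)\<^sup>2 + 2 * (cmod b)\<^sup>2"
        using sum_squares_bound[of "cmod a" "cmod b"] by (simp add: power2_sum)
      finally show ?thesis .
    qed
    then show "AE x in lebesgue. norm ((cmod (f x + g x))\<^sup>2)
        \<le> norm (2 * (cmod (f x))\<^sup>2 + 2 * (cmod (g x))\<^sup>2)"
      by (intro AE_I2) simp
  qed simp
qed

lemma square_integrable_cmult:
  "square_integrable f \<Longrightarrow> square_integrable (\<lambda>x. c * f x)"
  by (auto simp: square_integrable_def norm_mult power_mult_distrib)

lemma square_integrable_cmult2:
  "square_integrable f \<Longrightarrow> square_integrable (\<lambda>x. f x * c)"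
  by (auto simp: square_integrable_def norm_mult power_mult_distrib)

lemma square_integrable_zero: "square_integrable (\<lambda>x. 0)"
  by (simp add: square_integrable_def)

lemma square_integrable_indicator:
  assumes "square_integrable f" "A \<in> sets lebesgue"
  shows "square_integrable (\<lambda>x. indicator A x * f x)"
  unfolding square_integrable_def
proof (intro conjI)
  have [measurable]: "f \<in> borel_measurable lebesgue" "A \<in> sets lebesgue"
    using assms by (auto simp: square_integrable_def)
  show "(\<lambda>x. indicator A x * f x) \<in> borel_measurable lebesgue" by measurable
  then have [measurable]: "(\<lambda>x. indicator A x * f x) \<in> borel_measurable lebesgue" .
  show "integrable lebesgue (\<lambda>x. (cmod (indicator A x * f x))\<^sup>2)"
    by (rule Bochner_Integration.integrable_bound[where f = "\<lambda>x. (cmod (f x))\<^sup>2"])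
      (use assms in \<open>auto simp: square_integrable_def indicator_def\<close>)
qed

quotient_type L2 = "real \<Rightarrow> complex" /
  partial: "\<lambda>f g. square_integrable f \<and> square_integrable g \<and> (AE x in lebesgue. f x = g x)"
proof (rule part_equivpI)
  show "\<exists>f. square_integrable f \<and> square_integrable f \<and> (AE x in lebesgue. f x = f x)"
    using square_integrable_zero by auto
qed (auto simp: symp_def transp_def elim: eventually_elim2)

lemma square_integrable_rep_L2: "square_integrable (rep_L2 f)"
  using Quotient3_rep_reflp[OF Quotient3_L2] by auto

instantiation L2 :: ab_group_add
begin

lift_definition zero_L2 :: L2 is "\<lambda>_. 0"
  by (simp add: square_integrable_zero)

lift_definition plus_L2 :: "L2 \<Rightarrow> L2 \<Rightarrow> L2" is "\<lambda>f g x. f x + g x"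
  by (auto intro: square_integrable_add elim: eventually_elim2)

lift_definition uminus_L2 :: "L2 \<Rightarrow> L2" is "\<lambda>f x. - f x"
  using square_integrable_cmult[of _ "-1"] by auto

lift_definition minus_L2 :: "L2 \<Rightarrow> L2 \<Rightarrow> L2" is "\<lambda>f g x. f x - g x"
  using square_integrable_add[OF _ square_integrable_cmult[of _ "-1"]]
  by (auto elim: eventually_elim2)

instance
  by standard
    (transfer; use square_integrable_add square_integrable_zero
       square_integrable_cmult[of _ "-1"]
       square_integrable_add[OF _ square_integrable_cmult[of _ "-1"]]
     in \<open>auto simp: algebra_simps\<close>)+

end

lift_definition scaleC :: "complex \<Rightarrow> L2 \<Rightarrow> L2" (infixr "*\<^sub>C" 75) is "\<lambda>c f x. c * f x"
  by (auto intro: square_integrable_cmult)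

text \<open>Linear in the first argument, conjugate-linear in the second.\<close>

lift_definition cinner :: "L2 \<Rightarrow> L2 \<Rightarrow> complex" is
  "\<lambda>f g. LINT x|lebesgue. f x * cnj (g x)"
proof -
  fix f f' g g' :: "real \<Rightarrow> complex"
  assume f: "square_integrable f \<and> square_integrable f' \<and> (AE x in lebesgue. f x = f' x)"
    and g: "square_integrable g \<and> square_integrable g' \<and> (AE x in lebesgue. g x = g' x)"
  show "(LINT x|lebesgue. f x * cnj (g x)) = (LINT x|lebesgue. f' x * cnj (g' x))"
  proof (rule integral_cong_AE)
    show "AE x in lebesgue. f x * cnj (g x) = f' x * cnj (g' x)"
      using f g by (auto elim: eventually_elim2)
  qed (use f g square_integrable_mult_cnj in auto)
qed

text \<open>The norm below is the usual $L^2$ norm; as the type class for inner product spaces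
  is real, its inner product is the real part of the complex one.\<close>

instantiation L2 :: real_inner
begin

definition scaleR_L2 :: "real \<Rightarrow> L2 \<Rightarrow> L2" where "scaleR_L2 r f = complex_of_real r *\<^sub>C f"
definition inner_L2 :: "L2 \<Rightarrow> L2 \<Rightarrow> real" where "inner_L2 f g = Re (cinner f g)"
definition norm_L2 :: "L2 \<Rightarrow> real" where "norm_L2 f = sqrt (Re (cinner f f))"
definition dist_L2 :: "L2 \<Rightarrow> L2 \<Rightarrow> real" where "dist_L2 f g = norm (f - g)"
definition sgn_L2 :: "L2 \<Rightarrow> L2" where "sgn_L2 f = inverse (norm f) *\<^sub>R f"
definition uniformity_L2 :: "(L2 \<times> L2) filter" where
  "uniformity_L2 = (INF e\<in>{0<..}. principal {(f, g). dist f g < e})"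
definition open_L2 :: "L2 set \<Rightarrow> bool" where
  "open_L2 U \<longleftrightarrow> (\<forall>f\<in>U. \<forall>\<^sub>F (f', g) in uniformity. f' = f \<longrightarrow> g \<in> U)"

instance
proof
  fix f g h :: L2 and a b :: real and U :: "L2 set"
  show "a *\<^sub>R (f + g) = a *\<^sub>R f + a *\<^sub>R g"
    unfolding scaleR_L2_def
    by transfer (auto simp: algebra_simps intro!: square_integrable_add square_integrable_cmult square_integrable_cmult2)
  show "(a + b) *\<^sub>R f = a *\<^sub>R f + b *\<^sub>R f"
    unfolding scaleR_L2_def
    by transfer (auto simp: algebra_simps intro!: square_integrable_add square_integrable_cmult square_integrable_cmult2)
  show "a *\<^sub>R b *\<^sub>R f = (a * b) *\<^sub>R f"
    unfolding scaleR_L2_def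
    by transfer (auto simp: algebra_simps intro!: square_integrable_cmult square_integrable_cmult2)
  show "1 *\<^sub>R f = f"
    unfolding scaleR_L2_def by transfer auto
  show "dist f g = norm (f - g)" by (rule dist_L2_def)
  show "sgn f = inverse (norm f) *\<^sub>R f" by (rule sgn_L2_def)
  show "(uniformity :: (L2 \<times> L2) filter) = (INF e\<in>{0<..}. principal {(f, g). dist f g < e})"
    by (rule uniformity_L2_def)
  show "open U = (\<forall>f\<in>U. \<forall>\<^sub>F (f', g) in uniformity. f' = f \<longrightarrow> g \<in> U)"
    by (rule open_L2_def)
  show "norm f = sqrt (inner f f)"
    by (simp add: norm_L2_def inner_L2_def)
  have cnj_eq: "cinner g f = cnj (cinner f g)"
  proof transfer
    fix f g :: "real \<Rightarrow> complex"
    show "(LINT x|lebesgue. g x * cnj (f x)) = cnj (LINT x|lebesgue. f x * cnj (g x))"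
      using Bochner_Integration.integral_cnj[of lebesgue "\<lambda>x. f x * cnj (g x)"]
      by (simp add: mult.commute del: Bochner_Integration.integral_cnj)
  qed
  then show "inner f g = inner g f"
    by (simp add: inner_L2_def)
  have "cinner (f + g) h = cinner f h + cinner g h"
    by transfer (auto simp: algebra_simps
        intro!: Bochner_Integration.integral_add square_integrable_mult_cnj)
  then show "inner (f + g) h = inner f h + inner g h"
    by (simp add: inner_L2_def)
  have "cinner (c *\<^sub>C f) g = c * cinner f g" for c
    by transfer (simp add: mult.assoc)
  then show "inner (a *\<^sub>R f) g = a * inner f g"
    by (simp add: inner_L2_def scaleR_L2_def)
  have Re_eq: "Re (LINT x|lebesgue. u x * cnj (u x)) = (LINT x|lebesgue. (cmod (u x))\<^sup>2)" for u
  proof -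
    have "(LINT x|lebesgue. u x * cnj (u x)) = (LINT x|lebesgue. complex_of_real ((cmod (u x))\<^sup>2))"
      by (simp only: complex_norm_square)
    also have "\<dots> = complex_of_real (LINT x|lebesgue. (cmod (u x))\<^sup>2)"
      by (rule Bochner_Integration.integral_complex_of_real)
    finally show ?thesis by simp
  qed
  show "0 \<le> inner f f"
    unfolding inner_L2_def by transfer (simp add: Re_eq)
  show "(inner f f = 0) = (f = 0)"
    unfolding inner_L2_def
  proof transfer
    fix u :: "real \<Rightarrow> complex"
    assume u: "square_integrable u \<and> square_integrable u \<and> (AE x in lebesgue. u x = u x)"
    then show "(Re (LINT x|lebesgue. u x * cnj (u x)) = 0) =
        (square_integrable u \<and> square_integrable (\<lambda>_. 0) \<and> (AE x in lebesgue. u x = 0))"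
      by (simp add: Re_eq square_integrable_zero square_integrable_def integral_nonneg_eq_0_iff_AE)
  qed
qed

end

subsection \<open>Bounded operators\<close>

definition bounded_ops :: "(L2 \<Rightarrow> L2) set" where
  "bounded_ops = {S. bounded_linear S \<and> (\<forall>c f. S (c *\<^sub>C f) = c *\<^sub>C S f)}"

lift_definition cutoff :: "real \<Rightarrow> L2 \<Rightarrow> L2" is "\<lambda>r f x. indicator {-r<..<r} x * f x"
  by (auto intro: square_integrable_indicator)

definition nuclear :: "(L2 \<Rightarrow> L2) \<Rightarrow> bool" where
  "nuclear S \<longleftrightarrow> (\<exists>u v :: nat \<Rightarrow> L2. summable (\<lambda>k. norm (u k) * norm (v k)) \<and>
     (\<forall>f. (\<lambda>k. cinner f (u k) *\<^sub>C v k) sums S f))"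

definition regular_values :: "(L2 \<Rightarrow> L2) \<Rightarrow> complex set" where
  "regular_values S = {z. \<exists>A\<in>bounded_ops.
     (\<forall>f. A (f - z *\<^sub>C S f) = f) \<and> (\<forall>f. A f - z *\<^sub>C S (A f) = f)}"

definition fredholm_resolvent :: "(L2 \<Rightarrow> L2) \<Rightarrow> complex \<Rightarrow> L2 \<Rightarrow> L2" where
  "fredholm_resolvent S z = S \<circ> inv (\<lambda>f. f - z *\<^sub>C S f)"

definition characteristic_set :: "(L2 \<Rightarrow> L2) \<Rightarrow> complex set" where
  "characteristic_set S = UNIV - regular_values S"

definition point_characteristic_set :: "(L2 \<Rightarrow> L2) \<Rightarrow> complex set" where
  "point_characteristic_set S =
     {z \<in> characteristic_set S. {f. f - z *\<^sub>C S f = 0} \<noteq> {0}}"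

definition residual_characteristic_set :: "(L2 \<Rightarrow> L2) \<Rightarrow> complex set" where
  "residual_characteristic_set S =
     {z \<in> characteristic_set S. {f. f - z *\<^sub>C S f = 0} = {0} \<and>
        closure (range (\<lambda>f. f - z *\<^sub>C S f)) \<noteq> UNIV}"

subsection \<open>Kernels\<close>

definition C0_function :: "('a::real_normed_vector \<Rightarrow> 'b::real_normed_vector) \<Rightarrow> bool" where
  "C0_function f \<longleftrightarrow> continuous_on UNIV f \<and> (f \<longlongrightarrow> 0) at_infinity"

definition row_carleman :: "(real \<Rightarrow> real \<Rightarrow> complex) \<Rightarrow> real \<Rightarrow> L2" where
  "row_carleman K s = abs_L2 (\<lambda>t. cnj (K s t))"

definition col_carleman :: "(real \<Rightarrow> real \<Rightarrow> complex) \<Rightarrow> real \<Rightarrow> L2" where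
  "col_carleman K t = abs_L2 (\<lambda>s. K s t)"

text \<open>The Carleman functions take values in the space only if every row and every column
  is square integrable; \<open>abs_L2\<close> is unspecified elsewhere, so this is required explicitly.\<close>

definition K0_kernel :: "(real \<Rightarrow> real \<Rightarrow> complex) \<Rightarrow> bool" where
  "K0_kernel K \<longleftrightarrow>
     case_prod K \<in> borel_measurable lebesgue \<and>
     (AE s in lebesgue. square_integrable (\<lambda>t. K s t)) \<and>
     (AE t in lebesgue. square_integrable (\<lambda>s. K s t)) \<and>
     C0_function (case_prod K) \<and>
     (\<forall>s. square_integrable (\<lambda>t. cnj (K s t))) \<and> C0_function (row_carleman K) \<and>
     (\<forall>t. square_integrable (\<lambda>s. K s t)) \<and> C0_function (col_carleman K)"

definition induces :: "(real \<Rightarrow> real \<Rightarrow> complex) \<Rightarrow> (L2 \<Rightarrow> L2) \<Rightarrow> bool" where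
  "induces K S \<longleftrightarrow>
     (\<forall>f. AE s in lebesgue. rep_L2 (S f) s = (LINT t|lebesgue. K s t * rep_L2 f t))"

definition resolvent_kernel :: "(L2 \<Rightarrow> L2) \<Rightarrow> complex \<Rightarrow> real \<Rightarrow> real \<Rightarrow> complex" where
  "resolvent_kernel S z = (THE K. K0_kernel K \<and> induces K (fredholm_resolvent S z))"

definition relatively_compact_seq :: "(nat \<Rightarrow> 'a::real_normed_vector) \<Rightarrow> bool" where
  "relatively_compact_seq x \<longleftrightarrow>
     (\<forall>y. range y \<subseteq> range x \<longrightarrow> (\<exists>r l. strict_mono (r :: nat \<Rightarrow> nat) \<and> (y \<circ> r) \<longlonglongrightarrow> l))"

definition second_kind_solution ::
    "(real \<Rightarrow> real \<Rightarrow> complex) \<Rightarrow> complex \<Rightarrow> L2 \<Rightarrow> L2 \<Rightarrow> bool" where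
  "second_kind_solution K z g f \<longleftrightarrow>
     (AE s in lebesgue. rep_L2 f s - z * (LINT t|lebesgue. K s t * rep_L2 f t) = rep_L2 g s)"

end

theory Submission
  imports Defs
begin

text \<open>
  The theorem rests on how the resolvent Carleman functions arise from those of the truncated kernel.
  Write \<open>A\<^sub>n\<close> for the inverse of \<open>I - \<lambda>\<^sub>n T\<^sub>n\<close>, and \<open>t\<^sub>n(s)\<close>, \<open>t'\<^sub>n(t)\<close> for the row and column
  Carleman functions of the kernel of \<open>T\<^sub>n\<close>. The resolvent kernel then has the rows \<open>A\<^sub>n\<^sup>* t\<^sub>n(s)\<close> and the
  columns \<open>A\<^sub>n t'\<^sub>n(t)\<close> (lemma \<open>resolvent_kernel_carleman\<close>). This needs adjoints, hence completeness of
  the space and the Riesz representation theorem, and it needs that the adjoint of an operator induced by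
  a \<open>K\<^sup>0\<close>-kernel is induced by the conjugate transposed kernel (\<open>adj_kernel\<close>).

  If \<open>f = \<lambda> T f\<close>, then \<open>y\<^sub>n = (I - \<lambda>\<^sub>n T\<^sub>n) f\<close> tends to \<open>0\<close>, while \<open>T\<^sub>n f\<close> at \<open>s\<close> equals
  \<open>\<langle>f, t\<^sub>n(s)\<rangle> = \<langle>A\<^sub>n y\<^sub>n, t\<^sub>n(s)\<rangle> = \<langle>y\<^sub>n, A\<^sub>n\<^sup>* t\<^sub>n(s)\<rangle>\<close>. As soon as the resolvent rows are bounded in
  \<open>n\<close> for each \<open>s\<close>, this gives \<open>T f = 0\<close> and \<open>f = 0\<close> (\<open>eigenvector_zero\<close>). Bounded resolvent columns
  give in the same way that \<open>I - \<lambda> T\<close> has an injective adjoint (\<open>adj_eigenvector_zero\<close>), so that its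
  range is dense. These are the first two assertions.

  Under both compactness conditions, the equations satisfied by the resolvent rows and columns pass to the
  limit along subsequences, and the two injectivity statements make the limits unique. So the rows and
  columns converge in norm, to \<open>row_lim s\<close> and \<open>col_lim t\<close>, and the kernels converge pointwise to a kernel
  \<open>R\<close> with these rows and columns, conjugated in the case of the rows. The relation
  \<open>\<langle>f, t(s)\<rangle> = \<langle>(I - \<lambda> T) f, row_lim s\<rangle>\<close>, where \<open>t(s)\<close> is the row Carleman function of the kernel of
  \<open>T\<close>, shows that a solution \<open>f\<close> of \<open>(I - \<lambda> T) f = g\<close> has \<open>T f\<close> equal to the function \<open>h\<close> obtained by
  integrating \<open>R\<close> against \<open>g\<close>. For arbitrary \<open>g\<close> with \<open>h\<close> square integrable, the interchange of integrals
  amounts to \<open>h = T g + \<lambda> T h\<close>, that is, to \<open>g + \<lambda> h\<close> being a solution (\<open>solvable_iff\<close>).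
\<close>

section \<open>Representatives and the complex inner product\<close>

lemma square_integrable_cong_AE:
  assumes "square_integrable f" "AE x in lebesgue. f x = g x" "g \<in> borel_measurable lebesgue"
  shows "square_integrable g"
  unfolding square_integrable_def
proof
  have "AE x in lebesgue. (cmod (f x))\<^sup>2 = (cmod (g x))\<^sup>2" using assms(2) by eventually_elim simp
  moreover have "f \<in> borel_measurable lebesgue" "integrable lebesgue (\<lambda>x. (cmod (f x))\<^sup>2)"
    using assms(1) by (auto simp: square_integrable_def)
  ultimately show "integrable lebesgue (\<lambda>x. (cmod (g x))\<^sup>2)"
    using integrable_cong_AE[of "\<lambda>x. (cmod (f x))\<^sup>2" lebesgue "\<lambda>x. (cmod (g x))\<^sup>2"] assms(3) by simp
qed (fact assms(3))

lemma borel_measurable_rep_L2 [measurable]: "rep_L2 f \<in> borel_measurable lebesgue"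
  using square_integrable_rep_L2[of f] by (simp add: square_integrable_def)

lemma borel_measurable_cnj [measurable (raw)]:
  "f \<in> borel_measurable M \<Longrightarrow> (\<lambda>x. cnj (f x)) \<in> borel_measurable M"
  by (rule borel_measurable_continuous_on[of cnj, OF continuous_on_cnj[OF continuous_on_id]])

lemma square_integrable_cnj: "square_integrable (\<lambda>x. cnj (f x)) \<longleftrightarrow> square_integrable f"
proof -
  have "(\<lambda>x. cnj (f x)) \<in> borel_measurable lebesgue \<longleftrightarrow> f \<in> borel_measurable lebesgue"
    using borel_measurable_cnj[of f lebesgue] borel_measurable_cnj[of "\<lambda>x. cnj (f x)" lebesgue]
    unfolding complex_cnj_cnj by blast
  then show ?thesis unfolding square_integrable_def by simp
qed

lemma rep_abs_L2:
  assumes "square_integrable f" shows "AE x in lebesgue. rep_L2 (abs_L2 f) x = f x"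
  using Quotient3_rel_rep[OF Quotient3_L2] Quotient3_rep_abs[OF Quotient3_L2, of f] assms by auto

lemma abs_rep_L2: "abs_L2 (rep_L2 f) = f"
  by (rule Quotient3_abs_rep[OF Quotient3_L2])

lemma abs_L2_eqI:
  assumes "square_integrable f" "square_integrable g" "AE x in lebesgue. f x = g x"
  shows "abs_L2 f = abs_L2 g"
  using Quotient3_rel_abs[OF Quotient3_L2, of f g] assms by auto

lemma L2_eq_iff: "f = g \<longleftrightarrow> (AE x in lebesgue. rep_L2 f x = rep_L2 g x)"
  using abs_L2_eqI[OF square_integrable_rep_L2 square_integrable_rep_L2, of f g]
  by (auto simp: abs_rep_L2)

lemma L2_eqI: "AE x in lebesgue. rep_L2 f x = rep_L2 g x \<Longrightarrow> f = g"
  by (simp add: L2_eq_iff)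

lemma abs_L2_eqI_rep:
  assumes "square_integrable u" "AE x in lebesgue. u x = rep_L2 f x"
  shows "abs_L2 u = f"
  using abs_L2_eqI[OF assms(1) square_integrable_rep_L2 assms(2)] by (simp add: abs_rep_L2)

lemma rep_L2_zero: "AE x in lebesgue. rep_L2 0 x = 0"
  unfolding zero_L2_def using rep_abs_L2[OF square_integrable_zero] by simp

lemma rep_L2_plus: "AE x in lebesgue. rep_L2 (f + g) x = rep_L2 f x + rep_L2 g x"
  unfolding plus_L2_def
  by (simp add: rep_abs_L2 square_integrable_add square_integrable_rep_L2)

lemma square_integrable_diff:
  "square_integrable f \<Longrightarrow> square_integrable g \<Longrightarrow> square_integrable (\<lambda>x. f x - g x)"
  using square_integrable_add[OF _ square_integrable_cmult[of g "-1"], of f] by simp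

lemma rep_L2_minus: "AE x in lebesgue. rep_L2 (f - g) x = rep_L2 f x - rep_L2 g x"
  unfolding minus_L2_def
  by (simp add: rep_abs_L2 square_integrable_diff square_integrable_rep_L2)

lemma rep_L2_scaleC: "AE x in lebesgue. rep_L2 (c *\<^sub>C f) x = c * rep_L2 f x"
  unfolding scaleC_def
  by (simp add: rep_abs_L2 square_integrable_cmult square_integrable_rep_L2)

lemma rep_L2_cutoff: "AE x in lebesgue. rep_L2 (cutoff r f) x = indicator {-r<..<r} x * rep_L2 f x"
  unfolding cutoff_def
  by (simp add: rep_abs_L2 square_integrable_indicator square_integrable_rep_L2)

lemma cinner_eq_integral: "cinner f g = (LINT x|lebesgue. rep_L2 f x * cnj (rep_L2 g x))"
  by (simp add: cinner_def)

lemma cinner_eq_integralI: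
  assumes "AE x in lebesgue. rep_L2 f x = u x" "AE x in lebesgue. rep_L2 g x = v x"
    "u \<in> borel_measurable lebesgue" "v \<in> borel_measurable lebesgue"
  shows "cinner f g = (LINT x|lebesgue. u x * cnj (v x))"
  unfolding cinner_eq_integral
  by (rule integral_cong_AE) (use assms in auto)

lemma cinner_add_left: "cinner (f + g) h = cinner f h + cinner g h"
  by transfer (auto simp: algebra_simps
        intro!: Bochner_Integration.integral_add square_integrable_mult_cnj)

lemma cinner_scaleC_left: "cinner (c *\<^sub>C f) g = c * cinner f g"
  by transfer (simp add: mult.assoc)

lemma cinner_commute: "cinner g f = cnj (cinner f g)"
proof transfer
  fix f g :: "real \<Rightarrow> complex"
  show "(LINT x|lebesgue. g x * cnj (f x)) = cnj (LINT x|lebesgue. f x * cnj (g x))"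
    using Bochner_Integration.integral_cnj[of lebesgue "\<lambda>x. f x * cnj (g x)"]
    by (simp add: mult.commute del: Bochner_Integration.integral_cnj)
qed

lemma cinner_add_right: "cinner h (f + g) = cinner h f + cinner h g"
  using cinner_commute cinner_add_left by (metis complex_cnj_add)

lemma cinner_scaleC_right: "cinner f (c *\<^sub>C g) = cnj c * cinner f g"
  using cinner_commute cinner_scaleC_left by (metis complex_cnj_mult)

lemma scaleC_add_right: "c *\<^sub>C (f + g) = c *\<^sub>C f + c *\<^sub>C g"
  by transfer (auto simp: algebra_simps intro!: square_integrable_add square_integrable_cmult square_integrable_cmult2)

lemma scaleC_scaleC: "a *\<^sub>C b *\<^sub>C f = (a * b) *\<^sub>C f"
  by transfer (auto simp: algebra_simps intro!: square_integrable_cmult square_integrable_cmult2)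

lemma scaleC_add_left: "(a + b) *\<^sub>C f = a *\<^sub>C f + b *\<^sub>C f"
  by transfer (auto simp: algebra_simps intro!: square_integrable_add square_integrable_cmult square_integrable_cmult2)

lemma scaleC_one: "1 *\<^sub>C f = f"
  by transfer auto

lemma scaleC_zero [simp]: "0 *\<^sub>C f = 0" "c *\<^sub>C (0::L2) = 0"
  by (metis add_cancel_right_right scaleC_add_left) (metis add_cancel_right_right scaleC_add_right)

lemma scaleC_diff_right: "c *\<^sub>C (f - g) = c *\<^sub>C f - c *\<^sub>C g"
  by (metis add_diff_cancel_right' diff_add_cancel scaleC_add_right)

lemma cinner_zero [simp]: "cinner 0 f = 0" "cinner f 0 = 0"
  by (metis add_cancel_right_right cinner_add_left) (metis add_cancel_right_right cinner_add_right)

lemma cinner_diff_left: "cinner (f - g) h = cinner f h - cinner g h"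
  by (metis add_diff_cancel_right' diff_add_cancel cinner_add_left)

lemma cinner_diff_right: "cinner h (f - g) = cinner h f - cinner h g"
  by (metis add_diff_cancel_right' diff_add_cancel cinner_add_right)

lemma cinner_self: "cinner f f = complex_of_real ((norm f)\<^sup>2)"
proof -
  have "Im (cinner f f) = 0"
    using cinner_commute[of f f] by (metis Reals_cnj_iff complex_is_Real_iff)
  moreover have "Re (cinner f f) = (norm f)\<^sup>2"
    by (metis inner_L2_def power2_norm_eq_inner)
  ultimately show ?thesis by (simp add: complex_eq_iff)
qed

lemma norm_scaleC: "norm (c *\<^sub>C f) = cmod c * norm f"
proof -
  have "complex_of_real ((norm (c *\<^sub>C f))\<^sup>2) = complex_of_real ((cmod c * norm f)\<^sup>2)"
    unfolding cinner_self[symmetric] cinner_scaleC_left cinner_scaleC_right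
    by (simp add: cinner_self power_mult_distrib complex_norm_square del: of_real_power)
  then show ?thesis
    by (simp only: of_real_eq_iff) (simp add: power2_eq_iff_nonneg)
qed

text \<open>Multiplying \<open>f\<close> by a unimodular scalar makes the complex inner product real and
  nonnegative, so the Cauchy-Schwarz inequality of the real structure applies.\<close>

lemma cmod_cinner_le: "cmod (cinner f g) \<le> norm f * norm g"
proof -
  obtain u where u: "cmod u = 1" "u * cinner f g = complex_of_real (cmod (cinner f g))"
  proof (cases "cinner f g = 0")
    case True then show ?thesis using that[of 1] by simp
  next
    case False
    let ?z = "cinner f g"
    have "cnj ?z * ?z = complex_of_real (cmod ?z) * complex_of_real (cmod ?z)"
      using complex_norm_square[of ?z] by (simp add: power2_eq_square mult.commute)
    then have "cnj ?z / complex_of_real (cmod ?z) * ?z = complex_of_real (cmod ?z)"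
      using False by (simp add: field_simps)
    moreover have "cmod (cnj ?z / complex_of_real (cmod ?z)) = 1"
      using False by (simp add: norm_divide)
    ultimately show ?thesis using that by blast
  qed
  have "cmod (cinner f g) = inner (u *\<^sub>C f) g"
    by (simp add: inner_L2_def cinner_scaleC_left u)
  also have "\<dots> \<le> norm (u *\<^sub>C f) * norm g" by (rule norm_cauchy_schwarz)
  finally show ?thesis by (simp add: norm_scaleC u)
qed

lemma bounded_bilinear_cinner: "bounded_bilinear cinner"
proof
  fix f g h :: L2 and r :: real
  show "cinner (r *\<^sub>R f) g = r *\<^sub>R cinner f g"
    by (simp add: scaleR_L2_def cinner_scaleC_left scaleR_conv_of_real)
  show "cinner f (r *\<^sub>R g) = r *\<^sub>R cinner f g"
    by (simp add: scaleR_L2_def cinner_scaleC_right scaleR_conv_of_real)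
  show "\<exists>K. \<forall>f g. norm (cinner f g) \<le> norm f * norm g * K"
    using cmod_cinner_le by (intro exI[of _ 1]) simp
qed (simp_all add: cinner_add_left cinner_add_right)

lemmas tendsto_cinner = bounded_bilinear.tendsto[OF bounded_bilinear_cinner]
lemmas continuous_on_cinner = bounded_bilinear.continuous_on[OF bounded_bilinear_cinner]

lemma bounded_bilinear_scaleC: "bounded_bilinear scaleC"
proof
  fix f g :: L2 and r :: real and c d :: complex
  show "(r *\<^sub>R c) *\<^sub>C f = r *\<^sub>R (c *\<^sub>C f)" "c *\<^sub>C r *\<^sub>R f = r *\<^sub>R c *\<^sub>C f"
    by (simp_all add: scaleR_L2_def scaleC_scaleC scaleR_conv_of_real mult.commute)
  show "\<exists>K. \<forall>c f. norm (c *\<^sub>C f) \<le> norm c * norm f * K"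
    by (intro exI[of _ 1]) (simp add: norm_scaleC)
qed (simp_all add: scaleC_add_left scaleC_add_right)

lemmas tendsto_scaleC = bounded_bilinear.tendsto[OF bounded_bilinear_scaleC]

lemma cinner_ext: "(\<And>f. cinner f g = cinner f h) \<Longrightarrow> g = h"
  using cinner_self[of "g - h"] by (simp add: cinner_diff_right)

lemma norm_square_eq_integral: "(norm f)\<^sup>2 = (LINT x|lebesgue. (cmod (rep_L2 f x))\<^sup>2)"
proof -
  have "complex_of_real ((norm f)\<^sup>2) = (LINT x|lebesgue. complex_of_real ((cmod (rep_L2 f x))\<^sup>2))"
    unfolding cinner_self[symmetric] cinner_eq_integral by (simp only: complex_norm_square)
  then show ?thesis by (simp only: Bochner_Integration.integral_complex_of_real of_real_eq_iff)
qed

lemma nn_integral_rep_L2: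
  "(\<integral>\<^sup>+x. ennreal ((cmod (rep_L2 f x))\<^sup>2) \<partial>lebesgue) = ennreal ((norm f)\<^sup>2)"
  unfolding norm_square_eq_integral
  by (rule nn_integral_eq_integral) (use square_integrable_rep_L2[of f] in \<open>auto simp: square_integrable_def\<close>)

lemma square_integrable_iff_nn_integral:
  assumes [measurable]: "f \<in> borel_measurable lebesgue"
  shows "square_integrable f \<longleftrightarrow> (\<integral>\<^sup>+x. ennreal ((cmod (f x))\<^sup>2) \<partial>lebesgue) < \<infinity>"
  using assms by (simp add: square_integrable_def integrable_iff_bounded)

section \<open>Completeness of the space\<close>

lemma nn_integral_rep_diff:
  "(\<integral>\<^sup>+x. ennreal ((cmod (rep_L2 f x - rep_L2 g x))\<^sup>2) \<partial>lebesgue) = ennreal ((norm (f - g))\<^sup>2)"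
  unfolding nn_integral_rep_L2[of "f - g", symmetric]
  by (rule nn_integral_cong_AE) (use rep_L2_minus[of f g] in \<open>eventually_elim, simp\<close>)

text \<open>The summand \<open>k\<close> in the definition of \<open>r\<close> makes it strictly increasing, and the partial sum of
  the moduli of convergence \<open>N\<close> makes it at least \<open>N k\<close>.\<close>

lemma Cauchy_rapid_subsequence:
  fixes u :: "nat \<Rightarrow> 'a::metric_space"
  assumes "Cauchy u" "\<And>k. e k > 0"
  obtains r :: "nat \<Rightarrow> nat" where "strict_mono r" "\<And>j k. k \<le> j \<Longrightarrow> dist (u (r j)) (u (r k)) < e k"
proof -
  have "\<forall>k. \<exists>N. \<forall>m\<ge>N. \<forall>n\<ge>N. dist (u m) (u n) < e k"
    using assms unfolding Cauchy_def by blast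
  then obtain N where N: "\<And>k m n. N k \<le> m \<Longrightarrow> N k \<le> n \<Longrightarrow> dist (u m) (u n) < e k"
    by metis
  define r where "r k = k + (\<Sum>i\<le>k. N i)" for k
  have sm: "strict_mono r" by (intro strict_monoI_Suc) (simp add: r_def)
  have "N k \<le> r k" for k
    using member_le_sum[of k "{..k}" N] by (simp add: r_def)
  moreover have "r k \<le> r j" if "k \<le> j" for k j
    using sm that by (simp add: strict_mono_less_eq)
  ultimately show ?thesis using that sm N by (meson order_trans)
qed

lemma convergent_of_geometric_increments:
  fixes w :: "nat \<Rightarrow> 'a::banach"
  assumes "\<And>k. norm (w (Suc k) - w k) \<le> C * (1/2) ^ k"
  shows "convergent w"
proof -
  have "summable (\<lambda>k. C * (1/2) ^ k :: real)"
    by (intro summable_mult summable_geometric) simp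
  then have "summable (\<lambda>k. w (Suc k) - w k)"
    by (rule summable_comparison_test') (use assms in auto)
  then have "(\<lambda>n. \<Sum>k<n. w (Suc k) - w k) \<longlonglongrightarrow> (\<Sum>k. w (Suc k) - w k)"
    by (rule summable_LIMSEQ)
  then have "(\<lambda>n. (w n - w 0) + w 0) \<longlonglongrightarrow> (\<Sum>k. w (Suc k) - w k) + w 0"
    unfolding sum_lessThan_telescope by (intro tendsto_add tendsto_const)
  then show ?thesis by (auto simp: convergent_def)
qed

lemma ennreal_term_le_suminf: "f k \<le> (\<Sum>k. f k :: ennreal)"
  using sum_le_suminf[OF summableI, of "{k}" f] by simp

text \<open>Riesz-Fischer. Along a subsequence whose \<open>k\<close>-th increment has norm at most \<open>4\<^sup>-\<^sup>k\<close>,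
  the sum over \<open>k\<close> of \<open>4\<^sup>k\<close> times the squared modulus of the increment has a finite integral. At almost
  every point the increments are therefore at most a constant times \<open>2\<^sup>-\<^sup>k\<close>, and the subsequence
  converges there; Fatou's lemma shows that the pointwise limit is also the limit in norm.\<close>

instance L2 :: banach
proof
  fix u :: "nat \<Rightarrow> L2"
  assume u: "Cauchy u"
  obtain r where r: "strict_mono r" and rd: "\<And>j k. k \<le> j \<Longrightarrow> dist (u (r j)) (u (r k)) < (1/4) ^ k"
    using Cauchy_rapid_subsequence[OF u, of "\<lambda>k. (1/4) ^ k"] by auto
  define w where "w k = rep_L2 (u (r k))" for k
  have [measurable]: "w k \<in> borel_measurable lebesgue" for k by (simp add: w_def)
  have dist2: "(norm (u (r j) - u (r k)))\<^sup>2 \<le> ((1/4) ^ k)\<^sup>2" if "k \<le> j" for j k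
    using rd[OF that] by (intro power_mono) (auto simp: dist_norm)
  have inc: "(\<integral>\<^sup>+x. ennreal (4 ^ k * (cmod (w (Suc k) x - w k x))\<^sup>2) \<partial>lebesgue) \<le> ennreal ((1/4) ^ k)" for k
  proof -
    have "(\<integral>\<^sup>+x. ennreal (4 ^ k * (cmod (w (Suc k) x - w k x))\<^sup>2) \<partial>lebesgue)
        = ennreal (4 ^ k) * (\<integral>\<^sup>+x. ennreal ((cmod (w (Suc k) x - w k x))\<^sup>2) \<partial>lebesgue)"
      by (simp add: ennreal_mult nn_integral_cmult del: ennreal_power)
    also have "\<dots> = ennreal (4 ^ k * (norm (u (r (Suc k)) - u (r k)))\<^sup>2)"
      by (simp add: ennreal_mult w_def nn_integral_rep_diff del: ennreal_power)
    also have "\<dots> \<le> ennreal (4 ^ k * ((1/4) ^ k)\<^sup>2)"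
      using dist2[of k "Suc k"] by (intro ennreal_leI mult_left_mono) auto
    also have "4 ^ k * ((1/4) ^ k)\<^sup>2 = (1/4 :: real) ^ k"
      by (simp add: power2_eq_square power_divide field_simps)
    finally show ?thesis .
  qed
  have "(\<integral>\<^sup>+x. (\<Sum>k. ennreal (4 ^ k * (cmod (w (Suc k) x - w k x))\<^sup>2)) \<partial>lebesgue)
      \<le> (\<Sum>k. ennreal ((1/4) ^ k))"
    by (subst nn_integral_suminf) (auto intro!: suminf_le inc)
  also have "\<dots> < \<infinity>"
    by (subst suminf_ennreal2) (auto intro!: summable_geometric)
  finally have "(\<integral>\<^sup>+x. (\<Sum>k. ennreal (4 ^ k * (cmod (w (Suc k) x - w k x))\<^sup>2)) \<partial>lebesgue) \<noteq> \<infinity>"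
    by simp
  then have fin: "AE x in lebesgue. (\<Sum>k. ennreal (4 ^ k * (cmod (w (Suc k) x - w k x))\<^sup>2)) \<noteq> \<infinity>"
    by (intro nn_integral_noteq_infinite) auto
  have conv: "AE x in lebesgue. convergent (\<lambda>k. w k x)"
    using fin
  proof eventually_elim
    fix x assume x: "(\<Sum>k. ennreal (4 ^ k * (cmod (w (Suc k) x - w k x))\<^sup>2)) \<noteq> \<infinity>"
    define C where "C = enn2real (\<Sum>k. ennreal (4 ^ k * (cmod (w (Suc k) x - w k x))\<^sup>2))"
    have C: "C \<ge> 0" "(\<Sum>k. ennreal (4 ^ k * (cmod (w (Suc k) x - w k x))\<^sup>2)) = ennreal C"
      unfolding C_def using x by (simp_all only: enn2real_nonneg ennreal_enn2real_if infinity_ennreal_def if_False)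
    have "cmod (w (Suc k) x - w k x) \<le> sqrt C * (1/2) ^ k" for k
    proof -
      have "ennreal (4 ^ k * (cmod (w (Suc k) x - w k x))\<^sup>2) \<le> ennreal C"
        unfolding C(2)[symmetric] by (rule ennreal_term_le_suminf)
      then have "4 ^ k * (cmod (w (Suc k) x - w k x))\<^sup>2 \<le> C"
        by (simp only: ennreal_le_iff[OF C(1)])
      moreover have "(4::real) ^ k = (2 ^ k)\<^sup>2"
        by (simp add: power2_eq_square flip: power_mult_distrib)
      ultimately have "(2 ^ k * cmod (w (Suc k) x - w k x))\<^sup>2 \<le> C"
        by (simp add: power_mult_distrib)
      then have "2 ^ k * cmod (w (Suc k) x - w k x) \<le> sqrt C"
        by (rule real_le_rsqrt)
      then show ?thesis by (simp add: field_simps power_divide)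
    qed
    then show "convergent (\<lambda>k. w k x)" by (rule convergent_of_geometric_increments)
  qed
  define F where "F x = lim (\<lambda>k. w k x)" for x
  have [measurable]: "F \<in> borel_measurable lebesgue"
    unfolding F_def by (rule borel_measurable_lim_metric) simp
  have Fw: "(\<integral>\<^sup>+x. ennreal ((cmod (F x - w k x))\<^sup>2) \<partial>lebesgue) \<le> ennreal (((1/4) ^ k)\<^sup>2)" for k
  proof -
    have "(\<integral>\<^sup>+x. ennreal ((cmod (F x - w k x))\<^sup>2) \<partial>lebesgue)
        = (\<integral>\<^sup>+x. liminf (\<lambda>j. ennreal ((cmod (w j x - w k x))\<^sup>2)) \<partial>lebesgue)"
    proof (rule nn_integral_cong_AE, use conv in eventually_elim)
      fix x assume "convergent (\<lambda>k. w k x)"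
      then have "(\<lambda>j. w j x) \<longlonglongrightarrow> F x" by (simp add: F_def convergent_LIMSEQ_iff)
      then have "(\<lambda>j. ennreal ((cmod (w j x - w k x))\<^sup>2)) \<longlonglongrightarrow> ennreal ((cmod (F x - w k x))\<^sup>2)"
        by (intro tendsto_intros)
      then show "ennreal ((cmod (F x - w k x))\<^sup>2) = liminf (\<lambda>j. ennreal ((cmod (w j x - w k x))\<^sup>2))"
        by (intro lim_imp_Liminf[symmetric]) simp_all
    qed
    also have "\<dots> \<le> liminf (\<lambda>j. \<integral>\<^sup>+x. ennreal ((cmod (w j x - w k x))\<^sup>2) \<partial>lebesgue)"
      by (rule nn_integral_liminf) simp
    also have "\<dots> \<le> liminf (\<lambda>j. ennreal (((1/4) ^ k)\<^sup>2))"
    proof (rule Liminf_mono, use eventually_ge_at_top[of k] in eventually_elim)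
      fix j assume "k \<le> j"
      then show "(\<integral>\<^sup>+x. ennreal ((cmod (w j x - w k x))\<^sup>2) \<partial>lebesgue) \<le> ennreal (((1/4) ^ k)\<^sup>2)"
        using dist2[of k j] by (simp add: w_def nn_integral_rep_diff ennreal_leI del: ennreal_power)
    qed
    also have "\<dots> = ennreal (((1/4) ^ k)\<^sup>2)" by (simp add: Liminf_const)
    finally show ?thesis .
  qed
  have sqF: "square_integrable F"
  proof -
    have "square_integrable (\<lambda>x. F x - w 0 x)"
      by (subst square_integrable_iff_nn_integral) (use Fw[of 0] in \<open>auto intro: le_less_trans\<close>)
    then have "square_integrable (\<lambda>x. (F x - w 0 x) + w 0 x)"
      by (rule square_integrable_add) (simp add: w_def square_integrable_rep_L2)
    then show ?thesis by simp
  qed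
  have "norm (u (r k) - abs_L2 F) \<le> (1/4) ^ k" for k
  proof -
    have "ennreal ((norm (abs_L2 F - u (r k)))\<^sup>2) = (\<integral>\<^sup>+x. ennreal ((cmod (F x - w k x))\<^sup>2) \<partial>lebesgue)"
      unfolding nn_integral_rep_diff[symmetric] w_def
      by (rule nn_integral_cong_AE) (use rep_abs_L2[OF sqF] in \<open>eventually_elim, simp\<close>)
    also note Fw
    finally have "(norm (abs_L2 F - u (r k)))\<^sup>2 \<le> ((1/4) ^ k)\<^sup>2"
      by (simp del: ennreal_power)
    then have "norm (abs_L2 F - u (r k)) \<le> (1/4) ^ k"
      by (rule power2_le_imp_le) simp
    then show ?thesis by (simp add: norm_minus_commute)
  qed
  then have "\<forall>\<^sub>F k in sequentially. norm (u (r k) - abs_L2 F) \<le> (1/4) ^ k" by simp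
  moreover have "(\<lambda>k. (1/4) ^ k :: real) \<longlonglongrightarrow> 0"
    by (rule LIMSEQ_realpow_zero) auto
  ultimately have "(\<lambda>k. u (r k) - abs_L2 F) \<longlonglongrightarrow> 0"
    by (rule Lim_null_comparison)
  then have "(u \<circ> r) \<longlonglongrightarrow> abs_L2 F"
    by (simp add: LIM_zero_iff o_def)
  then show "convergent u"
    using Cauchy_converges_subseq[OF u r] by (auto simp: convergent_def)
qed

section \<open>Orthogonal complements and adjoints\<close>

lemma subspace_closure:
  fixes V :: "'a::real_normed_vector set"
  assumes V: "subspace V"
  shows "subspace (closure V)"
  unfolding subspace_def
proof (intro conjI ballI allI)
  show "0 \<in> closure V" using subspace_0[OF V] closure_subset by blast
next
  fix x y assume "x \<in> closure V" "y \<in> closure V"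
  then obtain a b where ab: "\<And>n. a n \<in> V" "a \<longlonglongrightarrow> x" "\<And>n. b n \<in> V" "b \<longlonglongrightarrow> y"
    unfolding closure_sequential by blast
  then show "x + y \<in> closure V"
    unfolding closure_sequential
    by (intro exI[of _ "\<lambda>n. a n + b n"]) (auto intro: subspace_add[OF V] tendsto_add)
next
  fix c x assume "x \<in> closure V"
  then obtain a where a: "\<And>n. a n \<in> V" "a \<longlonglongrightarrow> x" unfolding closure_sequential by blast
  then show "c *\<^sub>R x \<in> closure V"
    unfolding closure_sequential
    by (intro exI[of _ "\<lambda>n. c *\<^sub>R a n"]) (auto intro: subspace_scale[OF V] tendsto_scaleR)
qed

text \<open>A sequence in \<open>V\<close> minimising the distance to a point outside \<open>V\<close> is Cauchy by the
  parallelogram law; its limit is the foot of the perpendicular.\<close>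

lemma exists_orthogonal_closed_subspace:
  fixes V :: "'a::{real_inner, banach} set"
  assumes V: "subspace V" "closed V" "V \<noteq> UNIV"
  obtains g where "g \<noteq> 0" "\<And>v. v \<in> V \<Longrightarrow> inner g v = 0"
proof -
  obtain x where x: "x \<notin> V" using V(3) by auto
  have V0: "V \<noteq> {}" using subspace_0[OF V(1)] by auto
  define d where "d = infdist x V"
  have d0: "d \<ge> 0" by (simp add: d_def infdist_nonneg)
  have dle: "d \<le> norm (x - v)" if "v \<in> V" for v
    using infdist_le[OF that, of x] by (simp add: d_def dist_norm)
  have "\<exists>v\<in>V. norm (x - v) < d + 1 / real (Suc n)" for n
    using cInf_lessD[of "(\<lambda>v. dist x v) ` V" "d + 1 / real (Suc n)"] V0
    by (auto simp: d_def infdist_def dist_norm)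
  then obtain v where v: "\<And>n. v n \<in> V" "\<And>n. norm (x - v n) < d + 1 / real (Suc n)"
    by metis
  have lim: "(\<lambda>n. norm (x - v n)) \<longlonglongrightarrow> d"
  proof (rule tendsto_sandwich[OF _ _ tendsto_const])
    show "(\<lambda>n. d + 1 / real (Suc n)) \<longlonglongrightarrow> d"
      using tendsto_add[OF tendsto_const LIMSEQ_Suc[OF lim_1_over_n], of d] by simp
  qed (use v dle in \<open>auto intro: less_imp_le always_eventually\<close>)
  have par: "(norm (v m - v n))\<^sup>2 \<le> 2 * (norm (x - v m))\<^sup>2 + 2 * (norm (x - v n))\<^sup>2 - 4 * d\<^sup>2" for m n
  proof -
    have "(1/2) *\<^sub>R (v m + v n) \<in> V"
      using V(1) v(1) by (intro subspace_scale subspace_add)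
    then have "d \<le> norm (x - (1/2) *\<^sub>R (v m + v n))" by (rule dle)
    then have "d\<^sup>2 \<le> (norm (x - (1/2) *\<^sub>R (v m + v n)))\<^sup>2"
      using d0 by (intro power_mono)
    moreover have "(norm (v m - v n))\<^sup>2 = 2 * (norm (x - v m))\<^sup>2 + 2 * (norm (x - v n))\<^sup>2
        - 4 * (norm (x - (1/2) *\<^sub>R (v m + v n)))\<^sup>2"
      by (simp add: power2_norm_eq_inner inner_diff_left inner_diff_right inner_add_left
          inner_add_right inner_commute algebra_simps)
    ultimately show ?thesis by simp
  qed
  have "Cauchy v"
  proof (rule metric_CauchyI)
    fix e :: real assume e: "e > 0"
    have "(\<lambda>n. (norm (x - v n))\<^sup>2) \<longlonglongrightarrow> d\<^sup>2" by (intro tendsto_intros lim)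
    then have "\<forall>\<^sub>F n in sequentially. (norm (x - v n))\<^sup>2 < d\<^sup>2 + e\<^sup>2 / 4"
      by (rule order_tendstoD) (use e in simp)
    then obtain N where N: "\<And>n. n \<ge> N \<Longrightarrow> (norm (x - v n))\<^sup>2 < d\<^sup>2 + e\<^sup>2 / 4"
      by (auto simp: eventually_sequentially)
    have "dist (v m) (v n) < e" if "m \<ge> N" "n \<ge> N" for m n
    proof -
      have "(norm (v m - v n))\<^sup>2 < e\<^sup>2" using par[of m n] N[OF that(1)] N[OF that(2)] by simp
      then show ?thesis using e by (simp add: dist_norm power2_less_imp_less)
    qed
    then show "\<exists>N. \<forall>m\<ge>N. \<forall>n\<ge>N. dist (v m) (v n) < e" by blast
  qed
  then obtain p where p: "v \<longlonglongrightarrow> p" by (auto simp: Cauchy_convergent_iff convergent_def)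
  have pV: "p \<in> V" using V(2) v(1) p by (meson closed_sequentially)
  have np: "norm (x - p) = d"
    by (rule LIMSEQ_unique[OF _ lim]) (intro tendsto_intros p)
  show ?thesis
  proof (rule that[of "x - p"])
    show "x - p \<noteq> 0" using x pV by auto
    fix w assume w: "w \<in> V"
    show "inner (x - p) w = 0"
    proof (cases "w = 0")
      case False
      define t where "t = inner (x - p) w / (norm w)\<^sup>2"
      \<comment> \<open>\<open>p + t w\<close> is the point nearest to \<open>x\<close> on the line through \<open>p\<close> in direction \<open>w\<close>\<close>
      have "p + t *\<^sub>R w \<in> V" using V(1) pV w by (intro subspace_add subspace_scale)
      then have "d \<le> norm (x - (p + t *\<^sub>R w))" by (rule dle)
      then have "(norm (x - p))\<^sup>2 \<le> (norm (x - (p + t *\<^sub>R w)))\<^sup>2"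
        using d0 np by (intro power_mono) auto
      also have "\<dots> = (norm (x - p))\<^sup>2 - 2 * t * inner (x - p) w + t\<^sup>2 * (norm w)\<^sup>2"
        unfolding power2_norm_eq_inner
        by (simp add: inner_diff_left inner_diff_right inner_add_left
          inner_add_right inner_commute algebra_simps power2_eq_square)
      also have "\<dots> = (norm (x - p))\<^sup>2 - (inner (x - p) w)\<^sup>2 / (norm w)\<^sup>2"
        using False by (simp add: t_def power2_eq_square field_simps)
      finally have "(inner (x - p) w)\<^sup>2 / (norm w)\<^sup>2 \<le> 0" by simp
      then show ?thesis using False by (simp add: divide_le_0_iff)
    qed simp
  qed
qed

lemma bounded_opsI:
  assumes "\<And>f g. S (f + g) = S f + S g" "\<And>c f. S (c *\<^sub>C f) = c *\<^sub>C S f"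
    "\<And>f. norm (S f) \<le> C * norm f"
  shows "S \<in> bounded_ops"
proof -
  have "bounded_linear S"
    by (rule bounded_linear_intro[where K = C])
      (use assms in \<open>auto simp: scaleR_L2_def mult.commute\<close>)
  then show ?thesis using assms(2) by (simp add: bounded_ops_def)
qed

lemma bounded_ops_linear: "S \<in> bounded_ops \<Longrightarrow> bounded_linear S"
  by (simp add: bounded_ops_def)

lemma bounded_ops_scaleC: "S \<in> bounded_ops \<Longrightarrow> S (c *\<^sub>C f) = c *\<^sub>C S f"
  by (simp add: bounded_ops_def)

lemma bounded_ops_add: "S \<in> bounded_ops \<Longrightarrow> S (f + g) = S f + S g"
  using bounded_ops_linear[of S] by (simp add: linear_simps)

lemma bounded_ops_diff: "S \<in> bounded_ops \<Longrightarrow> S (f - g) = S f - S g"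
  using bounded_ops_linear[of S] by (simp add: linear_simps)

lemma bounded_ops_zero: "S \<in> bounded_ops \<Longrightarrow> S 0 = 0"
  using bounded_ops_linear[of S] by (simp add: linear_simps)

lemma bounded_ops_comp: "S \<in> bounded_ops \<Longrightarrow> S' \<in> bounded_ops \<Longrightarrow> S \<circ> S' \<in> bounded_ops"
  using bounded_linear_compose[of S S'] by (simp add: bounded_ops_def o_def)

lemma bounded_ops_bound: "S \<in> bounded_ops \<Longrightarrow> \<exists>C\<ge>0. \<forall>f. norm (S f) \<le> C * norm f"
  using bounded_linear.nonneg_bounded[OF bounded_ops_linear, of S] by (auto simp: mult.commute)

text \<open>Real orthogonality to a complex subspace is complex orthogonality: the imaginary part of the
  complex inner product is the real inner product with the vector rotated by \<open>\<i>\<close>.\<close>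

lemma cinner_zero_if_inner_zero:
  assumes "inner g v = 0" "inner g (\<i> *\<^sub>C v) = 0"
  shows "cinner v g = 0"
  using assms cinner_commute[of v g] by (simp add: inner_L2_def cinner_scaleC_right complex_eq_iff)

text \<open>The kernel of a nonzero functional has codimension one, so the representing vector is a
  multiple of any nonzero vector orthogonal to the kernel.\<close>

lemma riesz_representation:
  fixes \<phi> :: "L2 \<Rightarrow> complex"
  assumes add: "\<And>f g. \<phi> (f + g) = \<phi> f + \<phi> g" and scale: "\<And>c f. \<phi> (c *\<^sub>C f) = c * \<phi> f"
    and bound: "\<And>f. cmod (\<phi> f) \<le> C * norm f"
  shows "\<exists>w. \<forall>f. \<phi> f = cinner f w"
proof (cases "\<forall>f. \<phi> f = 0")
  case True
  then show ?thesis by (intro exI[of _ 0]) simp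
next
  case False
  have lin: "bounded_linear \<phi>"
    by (rule bounded_linear_intro[where K = C])
      (use add scale bound in \<open>auto simp: scaleR_L2_def scaleR_conv_of_real mult.commute\<close>)
  define V where "V = {f. \<phi> f = 0}"
  have "subspace V"
    unfolding V_def subspace_def using lin by (simp add: linear_simps add)
  moreover have "closed V"
    unfolding V_def using bounded_linear.continuous_on[OF lin continuous_on_id, of UNIV]
    by (intro closed_Collect_eq continuous_on_const)
  moreover have "V \<noteq> UNIV" using False by (auto simp: V_def)
  ultimately obtain g where g: "g \<noteq> 0" "\<And>v. v \<in> V \<Longrightarrow> inner g v = 0"
    using exists_orthogonal_closed_subspace by blast
  have perp: "cinner v g = 0" if "v \<in> V" for v
  proof -
    have v: "\<i> *\<^sub>C v \<in> V" using that by (simp add: V_def scale)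
    show ?thesis using g(2)[OF that] g(2)[OF v] by (rule cinner_zero_if_inner_zero)
  qed
  have "g \<notin> V" using g(1) g(2)[of g] by auto
  then have pg: "\<phi> g \<noteq> 0" by (simp add: V_def)
  have "\<phi> f = cinner f ((cnj (\<phi> g) / complex_of_real ((norm g)\<^sup>2)) *\<^sub>C g)" for f
  proof -
    have "\<phi> (f - (\<phi> f / \<phi> g) *\<^sub>C g) = 0"
      using lin pg by (simp add: linear_simps scale)
    then have "cinner (f - (\<phi> f / \<phi> g) *\<^sub>C g) g = 0" by (intro perp) (simp add: V_def)
    then have "cinner f g = \<phi> f / \<phi> g * complex_of_real ((norm g)\<^sup>2)"
      by (simp add: cinner_diff_left cinner_scaleC_left cinner_self)
    then show ?thesis using pg g(1) by (simp add: cinner_scaleC_right)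
  qed
  then show ?thesis by blast
qed

text \<open>For bounded \<open>S\<close> the Riesz representation theorem provides such a vector, and it is unique.\<close>

definition adj :: "(L2 \<Rightarrow> L2) \<Rightarrow> L2 \<Rightarrow> L2" where
  "adj S g = (SOME w. \<forall>f. cinner (S f) g = cinner f w)"

lemma cinner_adj:
  assumes S: "S \<in> bounded_ops" shows "cinner (S f) g = cinner f (adj S g)"
proof -
  obtain C where C: "C \<ge> 0" "\<And>f. norm (S f) \<le> C * norm f" using bounded_ops_bound[OF S] by auto
  have "\<exists>w. \<forall>f. cinner (S f) g = cinner f w"
  proof (rule riesz_representation)
    show "cmod (cinner (S f) g) \<le> C * norm g * norm f" for f
      using order_trans[OF cmod_cinner_le mult_right_mono[OF C(2) norm_ge_zero]]
      by (simp add: mult_ac)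
  qed (simp_all add: S bounded_ops_add bounded_ops_scaleC cinner_add_left cinner_scaleC_left)
  then show ?thesis unfolding adj_def by (rule someI2_ex) simp
qed

text \<open>The bound comes from \<open>\<parallel>S\<^sup>*g\<parallel>\<^sup>2 = \<langle>S S\<^sup>*g, g\<rangle> \<le> C \<parallel>S\<^sup>*g\<parallel> \<parallel>g\<parallel>\<close>.\<close>

lemma adj_bounded_ops:
  assumes S: "S \<in> bounded_ops" shows "adj S \<in> bounded_ops"
proof -
  obtain C where C: "C \<ge> 0" "\<And>f. norm (S f) \<le> C * norm f" using bounded_ops_bound[OF S] by auto
  show ?thesis
  proof (rule bounded_opsI)
    fix f g c
    show "adj S (f + g) = adj S f + adj S g"
      by (rule cinner_ext) (simp add: cinner_adj[OF S, symmetric] cinner_add_right)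
    show "adj S (c *\<^sub>C f) = c *\<^sub>C adj S f"
      by (rule cinner_ext) (simp add: cinner_adj[OF S, symmetric] cinner_scaleC_right)
    have "complex_of_real ((norm (adj S g))\<^sup>2) = cinner (S (adj S g)) g"
      by (simp only: cinner_self[symmetric] cinner_adj[OF S])
    then have "(norm (adj S g))\<^sup>2 = cmod (cinner (S (adj S g)) g)"
      by (metis abs_of_nonneg norm_of_real zero_le_power2)
    also have "\<dots> \<le> norm (S (adj S g)) * norm g" by (rule cmod_cinner_le)
    also have "\<dots> \<le> (C * norm (adj S g)) * norm g" by (intro mult_right_mono C) simp
    finally have "norm (adj S g) * norm (adj S g) \<le> norm (adj S g) * (C * norm g)"
      by (simp add: power2_eq_square mult_ac)
    then show "norm (adj S g) \<le> C * norm g"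
      using C(1) by (cases "adj S g = 0") (auto simp: mult_le_cancel_left)
  qed
qed

section \<open>Truncation to an interval\<close>

lemma norm_cutoff_le: "norm (cutoff r f) \<le> norm f"
proof (rule power2_le_imp_le)
  have "ennreal ((norm (cutoff r f))\<^sup>2) \<le> ennreal ((norm f)\<^sup>2)"
    unfolding nn_integral_rep_L2[symmetric]
    by (rule nn_integral_mono_AE) (use rep_L2_cutoff[of r f] in \<open>eventually_elim, auto simp: indicator_def\<close>)
  then show "(norm (cutoff r f))\<^sup>2 \<le> (norm f)\<^sup>2" by simp
qed simp

lemma cutoff_bounded_ops: "cutoff r \<in> bounded_ops"
proof (rule bounded_opsI[where C = 1])
  fix f g :: L2 and c
  show "cutoff r (f + g) = cutoff r f + cutoff r g"
    by (rule L2_eqI)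
      (use rep_L2_cutoff[of r "f + g"] rep_L2_cutoff[of r f] rep_L2_cutoff[of r g] rep_L2_plus[of f g]
         rep_L2_plus[of "cutoff r f" "cutoff r g"] in \<open>eventually_elim, simp add: algebra_simps\<close>)
  show "cutoff r (c *\<^sub>C f) = c *\<^sub>C cutoff r f"
    by (rule L2_eqI)
      (use rep_L2_cutoff[of r "c *\<^sub>C f"] rep_L2_cutoff[of r f] rep_L2_scaleC[of c f]
         rep_L2_scaleC[of c "cutoff r f"] in \<open>eventually_elim, simp add: algebra_simps\<close>)
qed (simp add: norm_cutoff_le)

lemma cinner_cutoff: "cinner (cutoff r f) g = cinner f (cutoff r g)"
  unfolding cinner_eq_integral
  by (rule integral_cong_AE)
    (use rep_L2_cutoff[of r f] rep_L2_cutoff[of r g] in \<open>simp, simp, eventually_elim, simp add: indicator_def\<close>)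

lemma norm_square_minus_cutoff:
  "(norm (f - cutoff r f))\<^sup>2 = (LINT x|lebesgue. indicator (- {-r<..<r}) x * (cmod (rep_L2 f x))\<^sup>2)"
  unfolding norm_square_eq_integral
proof (rule integral_cong_AE)
  have [measurable]: "- {-r<..<r} \<in> sets lebesgue" by (rule sets_completionI_sets) simp
  show "(\<lambda>x. indicator (- {-r<..<r}) x * (cmod (rep_L2 f x))\<^sup>2) \<in> borel_measurable lebesgue"
    by measurable
  show "AE x in lebesgue. (cmod (rep_L2 (f - cutoff r f) x))\<^sup>2
      = indicator (- {-r<..<r}) x * (cmod (rep_L2 f x))\<^sup>2"
    using rep_L2_cutoff[of r f] rep_L2_minus[of f "cutoff r f"]
    by eventually_elim (auto simp: indicator_def)
qed simp

lemma cutoff_tendsto: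
  assumes "filterlim \<tau> at_top sequentially"
  shows "(\<lambda>n. cutoff (\<tau> n) f) \<longlonglongrightarrow> f"
proof -
  have int: "integrable lebesgue (\<lambda>x. (cmod (rep_L2 f x))\<^sup>2)"
    using square_integrable_rep_L2[of f] by (simp add: square_integrable_def)
  have "(\<lambda>n. LINT x|lebesgue. indicator (- {-\<tau> n<..<\<tau> n}) x * (cmod (rep_L2 f x))\<^sup>2)
      \<longlonglongrightarrow> (LINT x::real|lebesgue. (0::real))"
  proof (rule integral_dominated_convergence[where w = "\<lambda>x. (cmod (rep_L2 f x))\<^sup>2"])
    show "(\<lambda>x. indicator (- {-\<tau> n<..<\<tau> n}) x * (cmod (rep_L2 f x))\<^sup>2) \<in> borel_measurable lebesgue" for n
    proof -
      have [measurable]: "- {-\<tau> n<..<\<tau> n} \<in> sets lebesgue" by (rule sets_completionI_sets) simp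
      show ?thesis by measurable
    qed
    show "AE x in lebesgue. (\<lambda>n. indicator (- {-\<tau> n<..<\<tau> n}) x * (cmod (rep_L2 f x))\<^sup>2) \<longlonglongrightarrow> 0"
    proof (rule AE_I2)
      fix x :: real
      have "\<forall>\<^sub>F n in sequentially. \<bar>x\<bar> < \<tau> n"
        using assms by (simp add: filterlim_at_top_dense)
      then have "\<forall>\<^sub>F n in sequentially. indicator (- {-\<tau> n<..<\<tau> n}) x * (cmod (rep_L2 f x))\<^sup>2 = 0"
        by eventually_elim (auto simp: indicator_def)
      then show "(\<lambda>n. indicator (- {-\<tau> n<..<\<tau> n}) x * (cmod (rep_L2 f x))\<^sup>2) \<longlonglongrightarrow> 0"
        by (rule tendsto_eventually)
    qed
  qed (use int in \<open>auto simp: indicator_def\<close>)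
  then have "(\<lambda>n. (norm (f - cutoff (\<tau> n) f))\<^sup>2) \<longlonglongrightarrow> 0"
    by (simp add: norm_square_minus_cutoff)
  then have "(\<lambda>n. sqrt ((norm (f - cutoff (\<tau> n) f))\<^sup>2)) \<longlonglongrightarrow> sqrt 0"
    by (rule tendsto_real_sqrt)
  then have "(\<lambda>n. norm (cutoff (\<tau> n) f - f)) \<longlonglongrightarrow> 0"
    by (simp add: norm_minus_commute)
  then show ?thesis by (simp add: tendsto_norm_zero_iff LIM_zero_iff)
qed

lemma cinner_shift_adj:
  assumes "S \<in> bounded_ops"
  shows "cinner f (g - cnj z *\<^sub>C adj S g) = cinner (f - z *\<^sub>C S f) g"
  by (simp add: cinner_diff_left cinner_diff_right cinner_scaleC_left cinner_scaleC_right cinner_adj[OF assms])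

lemma bounded_ops_tendsto:
  "S \<in> bounded_ops \<Longrightarrow> x \<longlonglongrightarrow> l \<Longrightarrow> (\<lambda>n. S (x n)) \<longlonglongrightarrow> S l"
  using bounded_linear.tendsto bounded_ops_linear by blast

text \<open>The truncations are uniformly bounded and converge strongly to the identity, which allows the
  argument to vary along the sequence.\<close>

lemma cutoff_tendsto_diagonal:
  assumes \<tau>: "filterlim \<tau> at_top sequentially" and x: "x \<longlonglongrightarrow> l"
  shows "(\<lambda>n. cutoff (\<tau> n) (x n)) \<longlonglongrightarrow> l"
proof -
  have "(\<lambda>n. cutoff (\<tau> n) (x n - l)) \<longlonglongrightarrow> 0"
  proof (rule Lim_null_comparison)
    show "\<forall>\<^sub>F n in sequentially. norm (cutoff (\<tau> n) (x n - l)) \<le> norm (x n - l)"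
      by (simp add: norm_cutoff_le)
    show "(\<lambda>n. norm (x n - l)) \<longlonglongrightarrow> 0"
      using x by (simp add: tendsto_norm_zero_iff LIM_zero_iff)
  qed
  from tendsto_add[OF this cutoff_tendsto[OF \<tau>, of l]] show ?thesis
    by (simp add: bounded_ops_diff[OF cutoff_bounded_ops])
qed

section \<open>Carleman functions and the kernel of the adjoint\<close>

lemma sigma_finite_lebesgue: "sigma_finite_measure (lebesgue :: real measure)"
proof
  obtain A :: "real set set" where A: "countable A" "A \<subseteq> sets lborel" "\<Union>A = space lborel"
      "\<forall>a\<in>A. emeasure lborel a \<noteq> \<infinity>"
    using lborel.sigma_finite_countable by blast
  show "\<exists>A::real set set. countable A \<and> A \<subseteq> sets lebesgue \<and> \<Union> A = space lebesgue \<and> (\<forall>a\<in>A. emeasure lebesgue a \<noteq> \<infinity>)"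
    using A by (intro exI[of _ A]) (auto simp: subset_eq)
qed

lemma C0_function_bounded:
  assumes "C0_function f"
  obtains M where "M > 0" "\<And>x :: real. norm (f x) \<le> M"
proof -
  have cont: "continuous_on UNIV f" and lim: "(f \<longlongrightarrow> 0) at_infinity"
    using assms by (auto simp: C0_function_def)
  have "\<forall>\<^sub>F x in at_infinity. dist (f x) 0 < 1" using lim by (rule tendstoD) simp
  then obtain b where b: "\<And>x. norm x \<ge> b \<Longrightarrow> norm (f x) < 1"
    by (auto simp: eventually_at_infinity)
  have "compact (f ` cball 0 b)"
    by (intro compact_continuous_image continuous_on_subset[OF cont]) auto
  then obtain M where M: "\<And>x. x \<in> cball 0 b \<Longrightarrow> norm (f x) \<le> M"
    by (meson bounded_iff compact_imp_bounded imageI)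
  have "norm (f x) \<le> max M 1" for x
    using b[of x] M[of x] by (cases "norm x \<ge> b") auto
  then show ?thesis by (intro that[of "max M 1"]) auto
qed

lemma rep_row_carleman: "K0_kernel K \<Longrightarrow> AE t in lebesgue. rep_L2 (row_carleman K s) t = cnj (K s t)"
  unfolding row_carleman_def by (rule rep_abs_L2) (simp add: K0_kernel_def)

lemma rep_col_carleman: "K0_kernel K \<Longrightarrow> AE s in lebesgue. rep_L2 (col_carleman K t) s = K s t"
  unfolding col_carleman_def by (rule rep_abs_L2) (simp add: K0_kernel_def)

lemma square_integrable_row: "K0_kernel K \<Longrightarrow> square_integrable (\<lambda>t. K s t)"
  unfolding K0_kernel_def square_integrable_cnj by blast

lemma square_integrable_col: "K0_kernel K \<Longrightarrow> square_integrable (\<lambda>s. K s t)"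
  by (simp add: K0_kernel_def)

lemma C0_carleman:
  assumes "K0_kernel K"
  shows "C0_function (row_carleman K)" "C0_function (col_carleman K)" "C0_function (case_prod K)"
    "continuous_on UNIV (row_carleman K)" "continuous_on UNIV (col_carleman K)"
    "continuous_on UNIV (case_prod K)"
  using assms by (auto simp: K0_kernel_def C0_function_def)

lemma borel_measurable_row [measurable (raw)]: "K0_kernel K \<Longrightarrow> (\<lambda>t. K s t) \<in> borel_measurable lebesgue"
  using square_integrable_row[of K s] by (simp add: square_integrable_def)

lemma borel_measurable_col: "K0_kernel K \<Longrightarrow> (\<lambda>s. K s t) \<in> borel_measurable lebesgue"
  using square_integrable_col[of K t] by (simp add: square_integrable_def)

lemma integral_row:
  assumes "K0_kernel K"
  shows "(LINT t|lebesgue. K s t * rep_L2 f t) = cinner f (row_carleman K s)"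
  using cinner_eq_integralI[OF AE_I2[OF refl] rep_row_carleman[OF assms, of s]
      borel_measurable_rep_L2 borel_measurable_cnj[OF borel_measurable_row[OF assms]], of f]
  by (simp add: mult.commute)

lemma integral_col:
  assumes "K0_kernel K"
  shows "(LINT s|lebesgue. K s t * cnj (rep_L2 g s)) = cinner (col_carleman K t) g"
  using cinner_eq_integralI[OF rep_col_carleman[OF assms, of t] AE_I2[OF refl]
      borel_measurable_col[OF assms] borel_measurable_rep_L2, of g] by simp

lemma induces_iff:
  "K0_kernel K \<Longrightarrow> induces K S \<longleftrightarrow> (\<forall>f. AE s in lebesgue. rep_L2 (S f) s = cinner f (row_carleman K s))"
  by (simp add: induces_def integral_row)

lemma borel_measurable_lebesgue_of_continuous:
  fixes f :: "real \<Rightarrow> 'a::topological_space"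
  shows "continuous_on UNIV f \<Longrightarrow> f \<in> borel_measurable lebesgue"
  by (intro measurable_completion) (simp add: borel_measurable_continuous_onI)

lemma continuous_on_cinner_col:
  "K0_kernel K \<Longrightarrow> continuous_on UNIV (\<lambda>t. cinner g (col_carleman K t))"
  by (intro continuous_on_cinner continuous_on_const C0_carleman)

lemma continuous_on_cinner_row:
  "K0_kernel K \<Longrightarrow> continuous_on UNIV (\<lambda>s. cinner g (row_carleman K s))"
  by (intro continuous_on_cinner continuous_on_const C0_carleman)

lemma borel_measurable_kernel_pair:
  assumes "K0_kernel K"
  shows "(\<lambda>(t, s). K s t) \<in> borel_measurable (lebesgue \<Otimes>\<^sub>M lebesgue)"
proof -
  have id: "(\<lambda>x::real. x) \<in> lebesgue \<rightarrow>\<^sub>M borel" by (intro measurable_completion) simp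
  have "case_prod K \<in> borel_measurable (borel \<Otimes>\<^sub>M borel)"
    unfolding borel_prod using C0_carleman(6)[OF assms] by (rule borel_measurable_continuous_onI)
  moreover have "(\<lambda>p. (snd p, fst p)) \<in> lebesgue \<Otimes>\<^sub>M lebesgue \<rightarrow>\<^sub>M (borel :: real measure) \<Otimes>\<^sub>M (borel :: real measure)"
    by (intro measurable_Pair measurable_compose[OF measurable_snd id] measurable_compose[OF measurable_fst id])
  ultimately have "(\<lambda>p. case_prod K (snd p, fst p)) \<in> borel_measurable (lebesgue \<Otimes>\<^sub>M lebesgue)"
    by (rule measurable_compose[rotated])
  then show ?thesis by (simp add: case_prod_beta)
qed

lemma mult_le_sum_squares: "a * b \<le> a\<^sup>2 + b\<^sup>2" if "a \<ge> 0" "b \<ge> 0" for a b :: real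
  using that sum_squares_bound[of a b] mult_nonneg_nonneg[OF that] by linarith

text \<open>The integrals of \<open>\<bar>K s t\<bar> \<bar>g s\<bar>\<close> over \<open>s\<close> are bounded uniformly in \<open>t\<close>, because the
  columns of \<open>K\<close> are bounded in norm; so integrability of \<open>f\<close> gives absolute integrability on the plane.
  Square integrability of \<open>f\<close> does not suffice for this estimate, which is why the adjoint is identified
  by means of test functions of bounded support.\<close>

lemma kernel_Fubini:
  assumes K: "K0_kernel K" and f: "integrable lebesgue f"
  shows "(LINT s|lebesgue. (LINT t|lebesgue. K s t * f t) * cnj (rep_L2 g s))
       = (LINT t|lebesgue. f t * cinner (col_carleman K t) g)"
proof -
  interpret sigma_finite_measure "lebesgue :: real measure" by (rule sigma_finite_lebesgue)
  interpret pair_sigma_finite "lebesgue :: real measure" "lebesgue :: real measure" ..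
  define h where "h t s = f t * (K s t * cnj (rep_L2 g s))" for t s
  obtain M where M: "M > 0" "\<And>t. norm (col_carleman K t) \<le> M"
    using C0_function_bounded[OF C0_carleman(2)[OF K]] by blast
  note [measurable] = borel_measurable_kernel_pair[OF K] borel_measurable_integrable[OF f]
  have meas: "case_prod h \<in> borel_measurable (lebesgue \<Otimes>\<^sub>M lebesgue)"
  proof -
    have "(\<lambda>p. K (snd p) (fst p)) \<in> borel_measurable (lebesgue \<Otimes>\<^sub>M lebesgue)"
      using borel_measurable_kernel_pair[OF K] by (simp add: case_prod_beta)
    then show ?thesis unfolding h_def case_prod_beta by measurable
  qed
  have int_s: "integrable lebesgue (\<lambda>s. K s t * cnj (rep_L2 g s))" for t
    by (rule square_integrable_mult_cnj[OF square_integrable_col[OF K] square_integrable_rep_L2])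
  have bound: "(LINT s|lebesgue. cmod (K s t * cnj (rep_L2 g s))) \<le> M\<^sup>2 + (norm g)\<^sup>2" for t
  proof -
    have i: "integrable lebesgue (\<lambda>s. (cmod (K s t))\<^sup>2)" "integrable lebesgue (\<lambda>s. (cmod (rep_L2 g s))\<^sup>2)"
      using square_integrable_col[OF K] square_integrable_rep_L2 by (auto simp: square_integrable_def)
    have "(LINT s|lebesgue. cmod (K s t * cnj (rep_L2 g s)))
        \<le> (LINT s|lebesgue. (cmod (K s t))\<^sup>2 + (cmod (rep_L2 g s))\<^sup>2)"
      by (intro integral_mono integrable_norm int_s Bochner_Integration.integrable_add i)
        (simp add: norm_mult mult_le_sum_squares)
    also have "\<dots> = (LINT s|lebesgue. (cmod (K s t))\<^sup>2) + (norm g)\<^sup>2"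
      by (simp add: i norm_square_eq_integral)
    also have "(LINT s|lebesgue. (cmod (K s t))\<^sup>2) = (norm (col_carleman K t))\<^sup>2"
      unfolding norm_square_eq_integral
    proof (rule integral_cong_AE)
      show "AE s in lebesgue. (cmod (K s t))\<^sup>2 = (cmod (rep_L2 (col_carleman K t) s))\<^sup>2"
        using rep_col_carleman[OF K, of t] by eventually_elim simp
    qed (use borel_measurable_col[OF K, of t] in measurable)
    also have "\<dots> \<le> M\<^sup>2" using M by (intro power_mono) auto
    finally show ?thesis by simp
  qed
  have "integrable (lebesgue \<Otimes>\<^sub>M lebesgue) (case_prod h)"
  proof (rule Fubini_integrable[OF meas])
    show "integrable lebesgue (\<lambda>t. LINT s|lebesgue. cmod (case_prod h (t, s)))"
    proof (rule Bochner_Integration.integrable_bound)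
      show "integrable lebesgue (\<lambda>t. (M\<^sup>2 + (norm g)\<^sup>2) * cmod (f t))"
        by (intro integrable_mult_right integrable_norm f)
      show "(\<lambda>t. LINT s|lebesgue. cmod (case_prod h (t, s))) \<in> borel_measurable lebesgue"
        using sigma_finite_measure.borel_measurable_lebesgue_integral[OF sigma_finite_lebesgue,
            of "\<lambda>t s. cmod (h t s)" lebesgue]
          measurable_compose[OF meas borel_measurable_norm]
        by (simp add: case_prod_beta)
      have "(LINT s|lebesgue. cmod (h t s)) \<le> (M\<^sup>2 + (norm g)\<^sup>2) * cmod (f t)" for t
        using mult_right_mono[OF bound[of t] norm_ge_zero[of "f t"]]
        by (simp add: h_def norm_mult mult.commute)
      then show "AE t in lebesgue. norm (LINT s|lebesgue. cmod (case_prod h (t, s)))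
          \<le> norm ((M\<^sup>2 + (norm g)\<^sup>2) * cmod (f t))"
        by simp
    qed
    show "AE t in lebesgue. integrable lebesgue (\<lambda>s. case_prod h (t, s))"
      using int_s by (simp add: h_def)
  qed
  then have "(LINT s|lebesgue. LINT t|lebesgue. h t s) = (LINT t|lebesgue. LINT s|lebesgue. h t s)"
    by (rule Fubini_integral)
  moreover have "(LINT t|lebesgue. h t s) = (LINT t|lebesgue. K s t * f t) * cnj (rep_L2 g s)" for s
    by (simp add: h_def mult.assoc[symmetric] mult.commute[of "f _"])
  moreover have "(LINT s|lebesgue. h t s) = f t * cinner (col_carleman K t) g" for t
    by (simp add: h_def integral_col[OF K])
  ultimately show ?thesis by simp
qed

text \<open>Both sides have the same inner product with every square integrable function that vanishes
  outside \<open>[-N, N]\<close>, since such functions are integrable and Fubini's theorem applies to them. Taking as test function the difference of the two sides, restricted to \<open>[-N, N]\<close>, shows that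
  they agree there.\<close>

lemma adj_kernel:
  assumes K: "K0_kernel K" and S: "S \<in> bounded_ops" and KS: "induces K S"
  shows "AE t in lebesgue. rep_L2 (adj S g) t = cinner g (col_carleman K t)"
proof -
  define h where "h t = cinner g (col_carleman K t)" for t
  define w where "w = rep_L2 (adj S g)"
  have h_cont: "continuous_on UNIV h" unfolding h_def by (rule continuous_on_cinner_col[OF K])
  have [measurable]: "h \<in> borel_measurable lebesgue" "w \<in> borel_measurable lebesgue"
    using borel_measurable_lebesgue_of_continuous[OF h_cont] by (auto simp: w_def)
  have "AE t in lebesgue. t \<in> {-real N..real N} \<longrightarrow> w t = h t" for N
  proof -
    let ?I = "{-real N..real N}"
    have I [measurable]: "?I \<in> sets lebesgue" by simp
    have sq_1: "square_integrable (indicator ?I)"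
      unfolding square_integrable_def
    proof
      have "(\<lambda>t. (cmod (indicator ?I t))\<^sup>2) = indicat_real ?I" by (auto simp: indicator_def)
      then show "integrable lebesgue (\<lambda>t. (cmod (indicator ?I t))\<^sup>2)" using I by simp
    qed (use I in measurable)
    obtain M where M: "\<And>t. t \<in> ?I \<Longrightarrow> cmod (h t) \<le> M"
    proof -
      have "compact (h ` ?I)"
        by (intro compact_continuous_image continuous_on_subset[OF h_cont]) auto
      then show ?thesis using that by (meson bounded_iff compact_imp_bounded imageI)
    qed
    have sq_h: "square_integrable (\<lambda>t. indicator ?I t * h t)"
      unfolding square_integrable_def
    proof
      show "integrable lebesgue (\<lambda>t. (cmod (indicator ?I t * h t))\<^sup>2)"
      proof (rule Bochner_Integration.integrable_bound)
        show "integrable lebesgue (\<lambda>t. M\<^sup>2 * (cmod (indicator ?I t))\<^sup>2)"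
          using sq_1 by (simp add: square_integrable_def)
        show "AE t in lebesgue. norm ((cmod (indicator ?I t * h t))\<^sup>2) \<le> norm (M\<^sup>2 * (cmod (indicator ?I t))\<^sup>2)"
          using M by (intro AE_I2) (auto simp: indicator_def intro!: power_mono)
      qed measurable
    qed measurable
    define d where "d t = indicator ?I t * w t - indicator ?I t * h t" for t
    have sq_d: "square_integrable d"
      unfolding d_def w_def by (intro square_integrable_diff square_integrable_indicator square_integrable_rep_L2 sq_h I)
    define f where "f = abs_L2 d"
    have rf: "AE t in lebesgue. rep_L2 f t = d t" unfolding f_def by (rule rep_abs_L2[OF sq_d])
    have dm [measurable]: "d \<in> borel_measurable lebesgue" using sq_d by (simp add: square_integrable_def)
    have int_d: "integrable lebesgue d"
      using square_integrable_mult_cnj[OF sq_d sq_1]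
      by (rule Bochner_Integration.integrable_cong[THEN iffD1, rotated -1]) (auto simp: d_def indicator_def)
    have "cinner f (adj S g) = (LINT t|lebesgue. d t * cnj (w t))"
      unfolding w_def by (rule cinner_eq_integralI[OF rf]) auto
    moreover have "cinner f (adj S g) = (LINT t|lebesgue. d t * cnj (h t))"
    proof -
      have "cinner f (adj S g) = cinner (S f) g" by (simp add: cinner_adj[OF S])
      also have "\<dots> = (LINT s|lebesgue. cinner f (row_carleman K s) * cnj (rep_L2 g s))"
        by (rule cinner_eq_integralI)
          (use KS in \<open>auto simp: induces_iff[OF K] intro: borel_measurable_lebesgue_of_continuous continuous_on_cinner_row[OF K]\<close>)
      also have "\<dots> = (LINT s|lebesgue. (LINT t|lebesgue. K s t * d t) * cnj (rep_L2 g s))"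
      proof -
        have "cinner f (row_carleman K s) = (LINT t|lebesgue. K s t * d t)" for s
          unfolding integral_row[OF K, symmetric]
        proof (rule integral_cong_AE)
          show "AE t in lebesgue. K s t * rep_L2 f t = K s t * d t"
            using rf by eventually_elim simp
        qed (use borel_measurable_row[OF K, of s] in measurable)
        then show ?thesis by simp
      qed
      also have "\<dots> = (LINT t|lebesgue. d t * cinner (col_carleman K t) g)"
        by (rule kernel_Fubini[OF K int_d])
      finally show ?thesis by (simp add: h_def cinner_commute[of g "col_carleman K _"])
    qed
    moreover have int1: "integrable lebesgue (\<lambda>t. d t * cnj (w t))"
      unfolding w_def by (rule square_integrable_mult_cnj[OF sq_d square_integrable_rep_L2])
    moreover have int2: "integrable lebesgue (\<lambda>t. d t * cnj (h t))"
      using square_integrable_mult_cnj[OF sq_d sq_h]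
      by (rule Bochner_Integration.integrable_cong[THEN iffD1, rotated -1]) (auto simp: d_def indicator_def)
    ultimately have "(LINT t|lebesgue. d t * cnj (w t) - d t * cnj (h t)) = 0"
      by simp
    moreover have "d t * cnj (w t) - d t * cnj (h t) = d t * cnj (d t)" for t
      by (auto simp: d_def indicator_def algebra_simps)
    ultimately have "(LINT t|lebesgue. complex_of_real ((cmod (d t))\<^sup>2)) = 0"
      by (simp only: complex_norm_square)
    then have "(LINT t|lebesgue. (cmod (d t))\<^sup>2) = 0"
      by (simp only: Bochner_Integration.integral_complex_of_real of_real_eq_0_iff)
    then have "AE t in lebesgue. (cmod (d t))\<^sup>2 = 0"
      by (subst (asm) integral_nonneg_eq_0_iff_AE) (use sq_d in \<open>auto simp: square_integrable_def\<close>)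
    then show ?thesis by eventually_elim (auto simp: d_def)
  qed
  then have "AE t in lebesgue. \<forall>N::nat. t \<in> {-real N..real N} \<longrightarrow> w t = h t"
    by (simp only: AE_all_countable) blast
  then show ?thesis
  proof eventually_elim
    case (elim t)
    obtain N :: nat where "\<bar>t\<bar> \<le> real N" using real_arch_simple by blast
    then show ?case using elim[rule_format, of N] by (auto simp: w_def h_def abs_le_iff)
  qed
qed

section \<open>Resolvent kernels\<close>

lemma C0_function_bounded_linear:
  assumes "C0_function f" "bounded_linear A"
  shows "C0_function (\<lambda>x. A (f x))"
  using assms bounded_linear.tendsto_zero[OF assms(2)]
  by (auto simp: C0_function_def intro: bounded_linear.continuous_on)

text \<open>Far out in the plane at least one of the two coordinates is large, so that one factor is
  small while the other stays bounded.\<close>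

lemma C0_function_product:
  fixes b :: "'a::real_normed_vector \<Rightarrow> 'b::real_normed_vector \<Rightarrow> 'c::real_normed_vector"
    and f :: "real \<Rightarrow> 'a" and g :: "real \<Rightarrow> 'b"
  assumes b: "bounded_bilinear b" and f: "C0_function f" and g: "C0_function g"
  shows "C0_function (\<lambda>(s, t). b (f s) (g t))"
proof -
  interpret bounded_bilinear b by (rule b)
  obtain C where C: "C > 0" "\<And>x y. norm (b x y) \<le> norm x * norm y * C"
    using pos_bounded by blast
  obtain M where M: "M > 0" "\<And>s. norm (f s) \<le> M" using C0_function_bounded[OF f] by blast
  obtain N where N: "N > 0" "\<And>s. norm (g s) \<le> N" using C0_function_bounded[OF g] by blast
  have cont: "continuous_on UNIV (\<lambda>(s, t). b (f s) (g t))"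
    unfolding case_prod_beta
    by (intro continuous_on continuous_on_compose2[of UNIV f _ fst] continuous_on_compose2[of UNIV g _ snd]
        continuous_intros) (use f g in \<open>auto simp: C0_function_def\<close>)
  have "((\<lambda>(s, t). b (f s) (g t)) \<longlongrightarrow> 0) at_infinity"
  proof (rule tendstoI)
    fix e :: real assume e: "e > 0"
    define d where "d = e / (C * max M N)"
    have d: "d > 0" using e C M N by (simp add: d_def)
    have "\<forall>\<^sub>F s in at_infinity. dist (f s) 0 < d" "\<forall>\<^sub>F t in at_infinity. dist (g t) 0 < d"
      using f g d by (auto simp: C0_function_def tendsto_iff)
    then obtain r1 r2 where r: "\<And>s. norm s \<ge> r1 \<Longrightarrow> norm (f s) < d" "\<And>t. norm t \<ge> r2 \<Longrightarrow> norm (g t) < d"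
      by (auto simp: eventually_at_infinity)
    have "dist (case p of (s, t) \<Rightarrow> b (f s) (g t)) 0 < e" if "norm p \<ge> \<bar>r1\<bar> + \<bar>r2\<bar>" for p
    proof -
      obtain s t where p: "p = (s, t)" by (cases p)
      have "\<bar>r1\<bar> + \<bar>r2\<bar> \<le> norm s + norm t" using that norm_Pair_le[of s t] p by simp
      then consider "norm s \<ge> r1" | "norm t \<ge> r2" by linarith
      then have "norm (f s) * norm (g t) < d * max M N"
      proof cases
        case 1
        have "norm (f s) * norm (g t) \<le> norm (f s) * N" by (intro mult_left_mono N) simp
        also have "\<dots> < d * N" using r(1)[OF 1] N by simp
        also have "\<dots> \<le> d * max M N" using d by simp
        finally show ?thesis .
      next
        case 2
        have "norm (f s) * norm (g t) \<le> M * norm (g t)" by (intro mult_right_mono M) simp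
        also have "\<dots> < M * d" using r(2)[OF 2] M by simp
        also have "\<dots> \<le> d * max M N" using d by simp
        finally show ?thesis .
      qed
      then have "norm (f s) * norm (g t) * C < d * max M N * C" using C by simp
      also have "\<dots> = e" using C M by (simp add: d_def)
      finally show ?thesis using C(2)[of "f s" "g t"] by (simp add: p)
    qed
    then show "\<forall>\<^sub>F p in at_infinity. dist (case p of (s, t) \<Rightarrow> b (f s) (g t)) 0 < e"
      unfolding eventually_at_infinity by blast
  qed
  with cont show ?thesis by (simp add: C0_function_def)
qed

lemma K0_kernelI:
  assumes "C0_function (case_prod K)"
    and row: "C0_function a" "\<And>s. AE t in lebesgue. rep_L2 (a s) t = cnj (K s t)"
    and col: "C0_function b" "\<And>t. AE s in lebesgue. rep_L2 (b t) s = K s t"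
  shows "K0_kernel K" "row_carleman K = a" "col_carleman K = b"
proof -
  have cont: "continuous_on UNIV (case_prod K)" using assms(1) by (simp add: C0_function_def)
  have meas: "(\<lambda>t. cnj (K s t)) \<in> borel_measurable lebesgue" "(\<lambda>t. K t s) \<in> borel_measurable lebesgue" for s
    by (auto intro!: borel_measurable_lebesgue_of_continuous continuous_on_cnj
        continuous_on_compose2[OF cont, of UNIV "\<lambda>t. (s, t)", simplified]
        continuous_on_compose2[OF cont, of UNIV "\<lambda>t. (t, s)", simplified] continuous_intros)
  have sq_row: "square_integrable (\<lambda>t. cnj (K s t))" for s
    by (rule square_integrable_cong_AE[OF square_integrable_rep_L2 row(2) meas(1)])
  have sq_col: "square_integrable (\<lambda>s. K s t)" for t
    by (rule square_integrable_cong_AE[OF square_integrable_rep_L2 col(2) meas(2)])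
  show ra: "row_carleman K = a"
    unfolding row_carleman_def
    by (rule ext, rule abs_L2_eqI_rep[OF sq_row]) (use row(2) in \<open>simp add: eq_commute\<close>)
  show cb: "col_carleman K = b"
    unfolding col_carleman_def
    by (rule ext, rule abs_L2_eqI_rep[OF sq_col]) (use col(2) in \<open>simp add: eq_commute\<close>)
  have "case_prod K \<in> borel_measurable lebesgue"
    by (intro measurable_completion) (simp add: borel_measurable_continuous_onI cont)
  then show "K0_kernel K"
    using assms(1) sq_row sq_col row(1) col(1) unfolding K0_kernel_def ra cb square_integrable_cnj
    by simp
qed

text \<open>The set where \<open>f\<close> and \<open>g\<close> differ is open, and a nonempty open set is not null.\<close>

lemma continuous_AE_eq:
  fixes f g :: "real \<Rightarrow> 'a::t2_space"
  assumes f: "continuous_on UNIV f" and g: "continuous_on UNIV g" and ae: "AE x in lebesgue. f x = g x"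
  shows "f x = g x"
proof (rule ccontr)
  assume "f x \<noteq> g x"
  have "open {x. f x \<noteq> g x}" by (intro open_Collect_neq f g)
  with \<open>f x \<noteq> g x\<close> obtain e where e: "e > 0" "ball x e \<subseteq> {x. f x \<noteq> g x}"
    unfolding open_contains_ball by blast
  have "AE y in lebesgue. y \<notin> ball x e" using ae e(2) by (auto elim!: eventually_mono)
  then have "ball x e \<in> null_sets lebesgue" by (subst AE_iff_null_sets) auto
  then have "negligible (ball x e)" by (simp add: negligible_iff_null_sets)
  then show False using e(1) open_not_negligible[of "ball x e"] by simp
qed

text \<open>For fixed \<open>f\<close> the value \<open>\<integral> K s t f t dt\<close> is continuous in \<open>s\<close>, so equality of the operators
  gives equality for every \<open>s\<close>; hence the rows agree in the Hilbert space, and by continuity of the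
  kernels they agree pointwise.\<close>

lemma K0_kernel_induces_unique:
  assumes K: "K0_kernel K" "induces K S" and L: "K0_kernel L" "induces L S"
  shows "K = L"
proof (intro ext)
  fix s t
  have row_eq: "row_carleman K s = row_carleman L s" for s
  proof (rule cinner_ext)
    fix f
    have "AE s in lebesgue. cinner f (row_carleman K s) = cinner f (row_carleman L s)"
      using K(2)[unfolded induces_iff[OF K(1)], rule_format, of f]
        L(2)[unfolded induces_iff[OF L(1)], rule_format, of f]
      by eventually_elim simp
    then show "cinner f (row_carleman K s) = cinner f (row_carleman L s)"
      by (intro continuous_AE_eq[of "\<lambda>s. cinner f (row_carleman K s)" "\<lambda>s. cinner f (row_carleman L s)"]
          continuous_on_cinner_row K L)
  qed
  have "AE t in lebesgue. K s t = L s t"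
    using rep_row_carleman[OF K(1), of s] rep_row_carleman[OF L(1), of s]
    unfolding row_eq by eventually_elim (metis complex_cnj_cancel_iff)
  then show "K s t = L s t"
    by (intro continuous_AE_eq[of "K s" "L s"]
        continuous_on_compose2[OF C0_carleman(6)[OF K(1)], of UNIV "\<lambda>t. (s, t)", simplified]
        continuous_on_compose2[OF C0_carleman(6)[OF L(1)], of UNIV "\<lambda>t. (s, t)", simplified] continuous_intros)
qed

lemma C0_function_add: "C0_function f \<Longrightarrow> C0_function g \<Longrightarrow> C0_function (\<lambda>x. f x + g x)"
  unfolding C0_function_def using tendsto_add_zero by (auto intro: continuous_on_add)

definition two_sided_inverse :: "(L2 \<Rightarrow> L2) \<Rightarrow> complex \<Rightarrow> (L2 \<Rightarrow> L2) \<Rightarrow> bool" where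
  "two_sided_inverse S z A \<longleftrightarrow> A \<in> bounded_ops \<and>
     (\<forall>f. A (f - z *\<^sub>C S f) = f) \<and> (\<forall>f. A f - z *\<^sub>C S (A f) = f)"

lemma regular_values_iff: "z \<in> regular_values S \<longleftrightarrow> (\<exists>A. two_sided_inverse S z A)"
  by (auto simp: regular_values_def two_sided_inverse_def)

lemma fredholm_resolvent_eq:
  assumes "two_sided_inverse S z A"
  shows "fredholm_resolvent S z = S \<circ> A"
proof -
  have "inv (\<lambda>f. f - z *\<^sub>C S f) = A"
    by (rule inv_equality) (use assms in \<open>auto simp: two_sided_inverse_def\<close>)
  then show ?thesis by (simp add: fredholm_resolvent_def)
qed

text \<open>Taking adjoints reverses products, so it exchanges the two one-sided inverse relations.\<close>

lemma adj_inverse: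
  assumes S: "S \<in> bounded_ops" and A: "two_sided_inverse S z A"
  shows "adj A f - cnj z *\<^sub>C adj S (adj A f) = f" and "adj A (f - cnj z *\<^sub>C adj S f) = f"
proof -
  have Ab: "A \<in> bounded_ops" using A by (simp add: two_sided_inverse_def)
  have "cinner h (adj A f - cnj z *\<^sub>C adj S (adj A f)) = cinner (A (h - z *\<^sub>C S h)) f" for h
    by (simp add: cinner_diff_right cinner_scaleC_right cinner_adj[OF S, symmetric] cinner_adj[OF Ab, symmetric]
        bounded_ops_diff[OF Ab] bounded_ops_scaleC[OF Ab] cinner_diff_left cinner_scaleC_left)
  then show "adj A f - cnj z *\<^sub>C adj S (adj A f) = f"
    by (intro cinner_ext) (use A in \<open>simp add: two_sided_inverse_def\<close>)
  have "cinner h (adj A (f - cnj z *\<^sub>C adj S f)) = cinner (A h - z *\<^sub>C S (A h)) f" for h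
    by (simp add: cinner_diff_right cinner_scaleC_right cinner_adj[OF S, symmetric] cinner_adj[OF Ab, symmetric]
        cinner_diff_left cinner_scaleC_left)
  then show "adj A (f - cnj z *\<^sub>C adj S f) = f"
    by (intro cinner_ext) (use A in \<open>simp add: two_sided_inverse_def\<close>)
qed

text \<open>The resolvent \<open>S A\<close>, with \<open>A\<close> the inverse of \<open>I - z S\<close>, sends \<open>f\<close> to the function
  \<open>s \<mapsto> \<langle>A f, k s\<rangle>\<close>, where \<open>k s\<close> is the row Carleman function of \<open>K\<close>. Its kernel should
  therefore have the rows \<open>A\<^sup>* (k s)\<close>, and symmetrically the columns \<open>A (k' t)\<close>. The identities
  \<open>A = I + z S A\<close> and \<open>A\<^sup>* = I + cnj z S\<^sup>* A\<^sup>*\<close> turn both into one pointwise formula,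
  whose continuity and decay are visible.\<close>

lemma resolvent_kernel_carleman:
  assumes K: "K0_kernel K" and S: "S \<in> bounded_ops" and KS: "induces K S"
    and A: "two_sided_inverse S z A"
  shows "resolvent_kernel S z = (\<lambda>s t. K s t + z * cinner (A (col_carleman K t)) (row_carleman K s))"
      (is "_ = ?R")
    and "row_carleman (resolvent_kernel S z) s = adj A (row_carleman K s)"
    and "col_carleman (resolvent_kernel S z) t = A (col_carleman K t)"
proof -
  have Ab: "A \<in> bounded_ops" using A by (simp add: two_sided_inverse_def)
  have bl: "bounded_linear A" "bounded_linear (adj A)"
    by (intro bounded_ops_linear Ab adj_bounded_ops)+
  have C0: "C0_function (case_prod ?R)"
  proof -
    have "C0_function (\<lambda>(s, t). cinner (A (col_carleman K t)) (row_carleman K s))"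
      by (rule C0_function_product[OF bounded_bilinear.flip[OF bounded_bilinear_cinner]
            C0_carleman(1)[OF K] C0_function_bounded_linear[OF C0_carleman(2)[OF K] bl(1)]])
    then have "C0_function (\<lambda>p. z * (case p of (s, t) \<Rightarrow> cinner (A (col_carleman K t)) (row_carleman K s)))"
      by (rule C0_function_bounded_linear[OF _ bounded_linear_mult_right])
    then have "C0_function (\<lambda>p. case_prod K p + z * (case p of (s, t) \<Rightarrow> cinner (A (col_carleman K t)) (row_carleman K s)))"
      by (rule C0_function_add[OF C0_carleman(3)[OF K]])
    then show ?thesis by (simp add: case_prod_beta')
  qed
  have row: "AE t in lebesgue. rep_L2 (adj A (row_carleman K s)) t = cnj (?R s t)" for s
  proof -
    let ?a = "adj A (row_carleman K s)"
    have "?a = row_carleman K s + cnj z *\<^sub>C adj S ?a"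
      using adj_inverse(1)[OF S A, of "row_carleman K s"] by (simp add: algebra_simps)
    then have rep: "rep_L2 ?a = rep_L2 (row_carleman K s + cnj z *\<^sub>C adj S ?a)" by simp
    show ?thesis
      using rep_L2_plus[of "row_carleman K s" "cnj z *\<^sub>C adj S ?a"] rep_L2_scaleC[of "cnj z" "adj S ?a"]
        rep_row_carleman[OF K, of s] adj_kernel[OF K S KS, of ?a]
      by eventually_elim
        (simp add: rep cinner_adj[OF Ab] cinner_commute[of "adj A _"])
  qed
  have col: "AE s in lebesgue. rep_L2 (A (col_carleman K t)) s = ?R s t" for t
  proof -
    let ?a = "A (col_carleman K t)"
    have "?a = col_carleman K t + z *\<^sub>C S ?a"
      using A by (simp add: two_sided_inverse_def algebra_simps)
    then have rep: "rep_L2 ?a = rep_L2 (col_carleman K t + z *\<^sub>C S ?a)" by simp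
    show ?thesis
      using rep_L2_plus[of "col_carleman K t" "z *\<^sub>C S ?a"] rep_L2_scaleC[of z "S ?a"]
        rep_col_carleman[OF K, of t] KS[unfolded induces_iff[OF K], rule_format, of ?a]
      by eventually_elim (simp add: rep)
  qed
  note R = K0_kernelI[OF C0 _ row _ col, OF C0_function_bounded_linear[OF C0_carleman(1)[OF K] bl(2)]
      C0_function_bounded_linear[OF C0_carleman(2)[OF K] bl(1)]]
  have ind: "induces ?R (fredholm_resolvent S z)"
    unfolding induces_iff[OF R(1)] fredholm_resolvent_eq[OF A] R(2)
    using KS by (simp add: induces_iff[OF K] cinner_adj[OF Ab, symmetric])
  show eq: "resolvent_kernel S z = ?R"
    unfolding resolvent_kernel_def
    by (rule the_equality) (use R(1) ind K0_kernel_induces_unique in blast)+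
  show "row_carleman (resolvent_kernel S z) s = adj A (row_carleman K s)"
    "col_carleman (resolvent_kernel S z) t = A (col_carleman K t)"
    unfolding eq R(2,3) by simp_all
qed

section \<open>Relatively compact sequences\<close>

lemma cinner_null_bounded:
  assumes y: "y \<longlonglongrightarrow> 0" and r: "bounded (range r)"
  shows "(\<lambda>n. cinner (y n) (r n)) \<longlonglongrightarrow> 0"
proof -
  obtain B where B: "\<And>n. norm (r n) \<le> B" using r by (auto simp: bounded_iff)
  show ?thesis
  proof (rule Lim_null_comparison)
    have "cmod (cinner (y n) (r n)) \<le> norm (y n) * B" for n
      using cmod_cinner_le[of "y n" "r n"] mult_left_mono[OF B[of n], of "norm (y n)"] by simp
    then show "\<forall>\<^sub>F n in sequentially. norm (cinner (y n) (r n)) \<le> norm (y n) * B" by simp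
    show "(\<lambda>n. norm (y n) * B) \<longlonglongrightarrow> 0"
      using tendsto_mult_left_zero[OF tendsto_norm_zero[OF y]] by simp
  qed
qed

text \<open>Otherwise some sequence of values would have norms tending to infinity and hence no
  convergent subsequence.\<close>

lemma relatively_compact_seq_bounded:
  assumes x: "relatively_compact_seq x"
  shows "bounded (range x)"
proof (rule ccontr)
  assume "\<not> bounded (range x)"
  then have "\<forall>k::nat. \<exists>n. norm (x n) > real k"
    unfolding bounded_iff by (force simp: not_le)
  then obtain m where m: "\<And>k. norm (x (m k)) > real k" by metis
  have "range (x \<circ> m) \<subseteq> range x" by auto
  then obtain r l where r: "strict_mono r" and l: "((x \<circ> m) \<circ> r) \<longlonglongrightarrow> l"
    using x unfolding relatively_compact_seq_def by blast
  have "bounded (range ((x \<circ> m) \<circ> r))" using l by (rule convergent_imp_bounded)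
  then obtain B where B: "\<And>k. norm (x (m (r k))) \<le> B" by (auto simp: bounded_iff)
  obtain k :: nat where "B \<le> real k" using real_arch_simple by blast
  also have "real k \<le> real (r k)" using seq_suble[OF r] by simp
  also have "\<dots> < norm (x (m (r k)))" by (rule m)
  finally show False using B[of k] by simp
qed

text \<open>A relatively compact sequence with only one possible subsequential limit converges: a
  subsequence staying away from that limit would again have a convergent subsequence. The predicate
  \<open>Q\<close> stands for an equation that passes to the limit and has at most one solution.\<close>

lemma relatively_compact_seq_converges:
  assumes x: "relatively_compact_seq x"
    and lim: "\<And>q l. strict_mono q \<Longrightarrow> (x \<circ> q) \<longlonglongrightarrow> l \<Longrightarrow> Q l"
    and unique: "\<And>l l'. Q l \<Longrightarrow> Q l' \<Longrightarrow> l = l'"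
  shows "\<exists>l. Q l \<and> x \<longlonglongrightarrow> l"
proof -
  have sub: "\<exists>r l. strict_mono r \<and> (x \<circ> (q \<circ> r)) \<longlonglongrightarrow> l" for q :: "nat \<Rightarrow> nat"
  proof -
    have "range (x \<circ> q) \<subseteq> range x" by auto
    then show ?thesis using x unfolding relatively_compact_seq_def by (metis comp_assoc)
  qed
  obtain r l where "strict_mono r" "(x \<circ> (id \<circ> r)) \<longlonglongrightarrow> l" using sub by blast
  then have l: "Q l" using lim by simp
  have "x \<longlonglongrightarrow> l"
  proof (rule ccontr)
    assume "\<not> x \<longlonglongrightarrow> l"
    then obtain e where e: "e > 0" "\<not> (\<forall>\<^sub>F n in sequentially. dist (x n) l < e)"
      by (auto simp: tendsto_iff)
    then have "infinite {n. \<not> dist (x n) l < e}"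
      by (simp add: frequently_cofinite not_eventually flip: cofinite_eq_sequentially)
    then obtain q :: "nat \<Rightarrow> nat" where q: "strict_mono q" "\<And>n. q n \<in> {n. \<not> dist (x n) l < e}"
      by (metis infinite_enumerate)
    obtain r l' where r: "strict_mono r" "(x \<circ> (q \<circ> r)) \<longlonglongrightarrow> l'" using sub by blast
    have "Q l'" using lim[OF strict_mono_o[OF q(1) r(1)] r(2)] .
    then have "(x \<circ> (q \<circ> r)) \<longlonglongrightarrow> l" using unique[OF l] r(2) by simp
    then have "\<forall>\<^sub>F n in sequentially. dist (x (q (r n))) l < e"
      using e(1) by (auto simp: tendsto_iff)
    then show False using q(2) by (auto simp: eventually_sequentially)
  qed
  with l show ?thesis by blast
qed

section \<open>Resolvents of the truncated operators\<close>

text \<open>The inverses of \<open>I - \<lambda>\<^sub>n T\<^sub>n\<close> are parameters because regularity of \<open>\<lambda>\<^sub>n\<close> only asserts that they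
  exist.\<close>

locale truncated_resolvents =
  fixes K :: "real \<Rightarrow> real \<Rightarrow> complex" and T :: "L2 \<Rightarrow> L2" and \<tau> :: "nat \<Rightarrow> real"
    and lam_n :: "nat \<Rightarrow> complex" and lam :: complex and A :: "nat \<Rightarrow> L2 \<Rightarrow> L2"
  assumes K: "K0_kernel K" and T: "T \<in> bounded_ops" and KT: "induces K T"
    and \<tau>: "filterlim \<tau> at_top sequentially"
    and K_trunc: "\<And>n. K0_kernel (\<lambda>s t. indicator {-\<tau> n<..<\<tau> n} s * K s t)"
    and A: "\<And>n. two_sided_inverse (cutoff (\<tau> n) \<circ> T) (lam_n n) (A n)"
    and lam_n: "lam_n \<longlonglongrightarrow> lam"
begin

abbreviation P :: "nat \<Rightarrow> L2 \<Rightarrow> L2" where "P n \<equiv> cutoff (\<tau> n)"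

abbreviation cut :: "nat \<Rightarrow> real \<Rightarrow> complex" where "cut n \<equiv> indicator {-\<tau> n<..<\<tau> n}"

abbreviation trunc :: "nat \<Rightarrow> real \<Rightarrow> real \<Rightarrow> complex" where "trunc n \<equiv> \<lambda>s t. cut n s * K s t"

abbreviation Kres :: "nat \<Rightarrow> real \<Rightarrow> real \<Rightarrow> complex" where
  "Kres n \<equiv> resolvent_kernel (P n \<circ> T) (lam_n n)"

lemma A_bounded_ops: "A n \<in> bounded_ops"
  using A by (simp add: two_sided_inverse_def)

lemma PT_bounded_ops: "P n \<circ> T \<in> bounded_ops"
  by (intro bounded_ops_comp cutoff_bounded_ops T)

lemma eventually_cut: "\<forall>\<^sub>F n in sequentially. cut n s = 1"
proof -
  have "\<forall>\<^sub>F n in sequentially. \<bar>s\<bar> < \<tau> n" using \<tau> by (simp add: filterlim_at_top_dense)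
  then show ?thesis by eventually_elim (auto simp: indicator_def)
qed

lemma cut_tendsto: "(\<lambda>n. cut n s) \<longlonglongrightarrow> 1"
  using eventually_cut by (rule tendsto_eventually)

lemma row_trunc: "row_carleman (trunc n) s = cut n s *\<^sub>C row_carleman K s"
proof (rule L2_eqI)
  show "AE t in lebesgue. rep_L2 (row_carleman (trunc n) s) t = rep_L2 (cut n s *\<^sub>C row_carleman K s) t"
    using rep_row_carleman[OF K_trunc, of n s] rep_row_carleman[OF K, of s]
      rep_L2_scaleC[of "cut n s" "row_carleman K s"]
    by eventually_elim (simp add: indicator_def)
qed

lemma col_trunc: "col_carleman (trunc n) t = P n (col_carleman K t)"
proof (rule L2_eqI)
  show "AE s in lebesgue. rep_L2 (col_carleman (trunc n) t) s = rep_L2 (P n (col_carleman K t)) s"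
    using rep_col_carleman[OF K_trunc, of n t] rep_col_carleman[OF K, of t]
      rep_L2_cutoff[of "\<tau> n" "col_carleman K t"]
    by eventually_elim simp
qed

lemma induces_trunc: "induces (trunc n) (P n \<circ> T)"
  unfolding induces_iff[OF K_trunc] row_trunc
proof
  fix f
  show "AE s in lebesgue. rep_L2 ((P n \<circ> T) f) s = cinner f (cut n s *\<^sub>C row_carleman K s)"
    using rep_L2_cutoff[of "\<tau> n" "T f"] KT[unfolded induces_iff[OF K], rule_format, of f]
    by eventually_elim (simp add: cinner_scaleC_right indicator_def)
qed

lemmas resolvent_trunc = resolvent_kernel_carleman[OF K_trunc PT_bounded_ops induces_trunc A]

lemma row_Kres: "row_carleman (Kres n) s = adj (A n) (cut n s *\<^sub>C row_carleman K s)"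
  by (simp add: resolvent_trunc(2) row_trunc)

lemma col_Kres: "col_carleman (Kres n) t = A n (P n (col_carleman K t))"
  by (simp add: resolvent_trunc(3) col_trunc)

lemma Kres_eq:
  "Kres n s t = cut n s * K s t + lam_n n * cinner (col_carleman (Kres n) t) (cut n s *\<^sub>C row_carleman K s)"
  unfolding col_Kres by (simp add: resolvent_trunc(1) row_trunc col_trunc)

lemma continuous_row_Kres: "continuous_on UNIV (row_carleman (Kres n))"
proof -
  have "continuous_on UNIV (\<lambda>s. adj (A n) (row_carleman (trunc n) s))"
    by (intro bounded_linear.continuous_on[OF bounded_ops_linear[OF adj_bounded_ops[OF A_bounded_ops]]]
        C0_carleman K_trunc)
  then show ?thesis by (simp add: resolvent_trunc(2)[abs_def])
qed

lemma adj_PT: "adj (P n \<circ> T) g = adj T (P n g)"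
  by (rule cinner_ext)
    (simp add: cinner_adj[OF PT_bounded_ops, symmetric] cinner_adj[OF T, symmetric] cinner_cutoff)

text \<open>The vector \<open>y n = (I - \<lambda>\<^sub>n T\<^sub>n) f\<close> tends to \<open>(I - \<lambda> T) f = 0\<close>, and \<open>f = A\<^sub>n (y n)\<close>. Hence
  \<open>T\<^sub>n f\<close> at the point \<open>s\<close> is the inner product of \<open>y n\<close> with the resolvent row at \<open>s\<close>. Bounded
  rows force \<open>T f = 0\<close>.\<close>

lemma eigenvector_zero:
  assumes bdd: "\<And>s. bounded (range (\<lambda>n. row_carleman (Kres n) s))"
    and f: "f = lam *\<^sub>C T f"
  shows "f = 0"
proof -
  define y where "y n = f - lam_n n *\<^sub>C P n (T f)" for n
  have "y \<longlonglongrightarrow> f - lam *\<^sub>C T f"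
    unfolding y_def by (intro tendsto_diff tendsto_const tendsto_scaleC lam_n cutoff_tendsto \<tau>)
  then have y: "y \<longlonglongrightarrow> 0" using f by simp
  have Ay: "A n (y n) = f" for n
    using A[of n] by (simp add: y_def two_sided_inverse_def)
  have "cinner f (row_carleman K s) = 0" for s
  proof -
    have "cinner (y n) (row_carleman (Kres n) s) = cut n s * cinner f (row_carleman K s)" for n
      unfolding row_Kres cinner_adj[OF A_bounded_ops, symmetric] Ay
      by (simp add: cinner_scaleC_right indicator_def)
    then have "(\<lambda>n. cut n s * cinner f (row_carleman K s)) \<longlonglongrightarrow> 0"
      using cinner_null_bounded[OF y bdd[of s]] by simp
    moreover have "(\<lambda>n. cut n s * cinner f (row_carleman K s)) \<longlonglongrightarrow> 1 * cinner f (row_carleman K s)"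
      by (intro tendsto_mult tendsto_const cut_tendsto)
    ultimately show ?thesis using LIMSEQ_unique by fastforce
  qed
  then have "AE s in lebesgue. rep_L2 (T f) s = rep_L2 0 s"
    using KT[unfolded induces_iff[OF K], rule_format, of f] rep_L2_zero by auto
  then have "T f = 0" by (rule L2_eqI)
  then show ?thesis using f by simp
qed

text \<open>The same argument for the adjoints, with the resolvent columns in place of the rows.\<close>

lemma adj_eigenvector_zero:
  assumes bdd: "\<And>t. bounded (range (\<lambda>n. col_carleman (Kres n) t))"
    and g: "g = cnj lam *\<^sub>C adj T g"
  shows "g = 0"
proof -
  define y where "y n = g - cnj (lam_n n) *\<^sub>C adj T (P n g)" for n
  have "y \<longlonglongrightarrow> g - cnj lam *\<^sub>C adj T g"
    unfolding y_def
    by (intro tendsto_diff tendsto_const tendsto_scaleC tendsto_cnj lam_n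
        bounded_ops_tendsto[OF adj_bounded_ops[OF T]] cutoff_tendsto \<tau>)
  then have y: "y \<longlonglongrightarrow> 0" using g by simp
  have Ay: "adj (A n) (y n) = g" for n
    using adj_inverse(2)[OF PT_bounded_ops A[of n], of g] by (simp add: y_def adj_PT)
  have "cinner g (col_carleman K t) = 0" for t
  proof -
    have "cinner (y n) (col_carleman (Kres n) t) = cinner g (P n (col_carleman K t))" for n
      unfolding col_Kres
      by (subst (1 2) cinner_commute) (simp add: cinner_adj[OF A_bounded_ops] Ay)
    then have "(\<lambda>n. cinner g (P n (col_carleman K t))) \<longlonglongrightarrow> 0"
      using cinner_null_bounded[OF y bdd[of t]] by simp
    moreover have "(\<lambda>n. cinner g (P n (col_carleman K t))) \<longlonglongrightarrow> cinner g (col_carleman K t)"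
      by (intro tendsto_cinner tendsto_const cutoff_tendsto \<tau>)
    ultimately show ?thesis using LIMSEQ_unique by blast
  qed
  then have "AE t in lebesgue. rep_L2 (adj T g) t = rep_L2 0 t"
    using adj_kernel[OF K T KT, of g] rep_L2_zero by auto
  then have "adj T g = 0" by (rule L2_eqI)
  then show ?thesis using g by simp
qed

lemma not_point_characteristic:
  assumes "\<And>s. bounded (range (\<lambda>n. row_carleman (Kres n) s))"
  shows "lam \<notin> point_characteristic_set T"
proof -
  have "f = 0" if "f - lam *\<^sub>C T f = 0" for f
    using that by (intro eigenvector_zero[OF assms]) simp_all
  then have "{f. f - lam *\<^sub>C T f = 0} = {0}"
    using bounded_ops_zero[OF T] by auto
  then show ?thesis by (simp add: point_characteristic_set_def)
qed

text \<open>A nonzero vector orthogonal to the range of \<open>I - \<lambda> T\<close> would be a null vector of its adjoint.\<close>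

lemma not_residual_characteristic:
  assumes "\<And>t. bounded (range (\<lambda>n. col_carleman (Kres n) t))"
  shows "lam \<notin> residual_characteristic_set T"
proof
  assume "lam \<in> residual_characteristic_set T"
  define V where "V = range (\<lambda>f. f - lam *\<^sub>C T f)"
  have "closure V \<noteq> UNIV"
    using \<open>lam \<in> residual_characteristic_set T\<close> by (simp add: residual_characteristic_set_def V_def)
  have lin: "bounded_linear (\<lambda>f. f - lam *\<^sub>C T f)"
    by (intro bounded_linear_sub bounded_linear_ident
        bounded_linear_compose[OF bounded_bilinear.bounded_linear_right[OF bounded_bilinear_scaleC]]
        bounded_ops_linear T)
  have "subspace V"
    unfolding V_def
    by (rule linear_subspace_image[OF bounded_linear.linear[OF lin] subspace_UNIV])
  then have "subspace (closure V)" by (rule subspace_closure)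
  then obtain g where g: "g \<noteq> 0" "\<And>v. v \<in> closure V \<Longrightarrow> inner g v = 0"
    using exists_orthogonal_closed_subspace[of "closure V"] \<open>closure V \<noteq> UNIV\<close> by auto
  have "cinner f (g - cnj lam *\<^sub>C adj T g) = 0" for f
  proof -
    let ?v = "f - lam *\<^sub>C T f"
    have "\<i> *\<^sub>C ?v = \<i> *\<^sub>C f - lam *\<^sub>C T (\<i> *\<^sub>C f)"
      by (simp add: scaleC_diff_right scaleC_scaleC bounded_ops_scaleC[OF T] mult.commute)
    then have "?v \<in> closure V" "\<i> *\<^sub>C ?v \<in> closure V"
      using closure_subset[of V] by (auto simp: V_def)
    then have "cinner ?v g = 0"
      by (intro cinner_zero_if_inner_zero g)
    then show ?thesis by (simp add: cinner_shift_adj[OF T])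
  qed
  then have "g - cnj lam *\<^sub>C adj T g = 0"
    by (intro cinner_ext) simp
  then have "g = 0" by (intro adj_eigenvector_zero[OF assms]) simp_all
  then show False using g(1) by simp
qed

end

section \<open>Limits of the resolvent Carleman functions\<close>

locale compact_truncated_resolvents = truncated_resolvents +
  assumes rows: "\<And>s. relatively_compact_seq (\<lambda>n. row_carleman (Kres n) s)"
    and cols: "\<And>t. relatively_compact_seq (\<lambda>n. col_carleman (Kres n) t)"
begin

lemmas row_bounded = relatively_compact_seq_bounded[OF rows]
lemmas col_bounded = relatively_compact_seq_bounded[OF cols]

lemma solution_unique:
  assumes "f - lam *\<^sub>C T f = g" "f' - lam *\<^sub>C T f' = g"
  shows "f = f'"
proof -
  have "(f - f') - lam *\<^sub>C T (f - f') = (f - lam *\<^sub>C T f) - (f' - lam *\<^sub>C T f')"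
    by (simp add: bounded_ops_diff[OF T] scaleC_diff_right)
  then have "f - f' = lam *\<^sub>C T (f - f')" using assms by simp
  then show ?thesis using eigenvector_zero[OF row_bounded] by fastforce
qed

lemma adj_solution_unique:
  assumes "f - cnj lam *\<^sub>C adj T f = g" "f' - cnj lam *\<^sub>C adj T f' = g"
  shows "f = f'"
proof -
  have "(f - f') - cnj lam *\<^sub>C adj T (f - f') = (f - cnj lam *\<^sub>C adj T f) - (f' - cnj lam *\<^sub>C adj T f')"
    by (simp add: bounded_ops_diff[OF adj_bounded_ops[OF T]] scaleC_diff_right)
  then have "f - f' = cnj lam *\<^sub>C adj T (f - f')" using assms by simp
  then show ?thesis using adj_eigenvector_zero[OF col_bounded] by fastforce
qed

text \<open>The resolvent row solves \<open>(I - cnj \<lambda>\<^sub>n T\<^sub>n\<^sup>*) x = t\<^sub>n(s)\<close>, where \<open>t\<^sub>n(s)\<close> is the row of the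
  truncated kernel. This equation passes to the limit along subsequences, and the limit equation has at
  most one solution.\<close>

lemma row_limit_exists:
  "\<exists>l. l - cnj lam *\<^sub>C adj T l = row_carleman K s \<and> (\<lambda>n. row_carleman (Kres n) s) \<longlonglongrightarrow> l"
proof (rule relatively_compact_seq_converges[OF rows])
  fix q l assume q: "strict_mono q" and l: "((\<lambda>n. row_carleman (Kres n) s) \<circ> q) \<longlonglongrightarrow> l"
  define x where "x n = row_carleman (Kres (q n)) s" for n
  have x: "x \<longlonglongrightarrow> l" using l unfolding x_def comp_def .
  have \<tau>q: "filterlim (\<lambda>n. \<tau> (q n)) at_top sequentially"
    by (rule filterlim_compose[OF \<tau> filterlim_subseq[OF q]])
  have "x n - cnj (lam_n (q n)) *\<^sub>C adj T (P (q n) (x n)) = cut (q n) s *\<^sub>C row_carleman K s" for n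
    unfolding x_def row_Kres adj_PT[symmetric] by (rule adj_inverse(1)[OF PT_bounded_ops A])
  moreover have "(\<lambda>n. x n - cnj (lam_n (q n)) *\<^sub>C adj T (P (q n) (x n))) \<longlonglongrightarrow> l - cnj lam *\<^sub>C adj T l"
    by (intro tendsto_diff tendsto_scaleC tendsto_cnj x bounded_ops_tendsto[OF adj_bounded_ops[OF T]]
        cutoff_tendsto_diagonal \<tau>q) (use LIMSEQ_subseq_LIMSEQ[OF lam_n q] in \<open>simp add: o_def\<close>)
  moreover have "(\<lambda>n. cut (q n) s *\<^sub>C row_carleman K s) \<longlonglongrightarrow> 1 *\<^sub>C row_carleman K s"
    by (intro tendsto_scaleC tendsto_const)
      (use LIMSEQ_subseq_LIMSEQ[OF cut_tendsto q] in \<open>simp add: o_def\<close>)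
  ultimately show "l - cnj lam *\<^sub>C adj T l = row_carleman K s"
    using LIMSEQ_unique by (simp add: scaleC_one)
qed (rule adj_solution_unique)

lemma col_limit_exists:
  "\<exists>l. l - lam *\<^sub>C T l = col_carleman K t \<and> (\<lambda>n. col_carleman (Kres n) t) \<longlonglongrightarrow> l"
proof (rule relatively_compact_seq_converges[OF cols])
  fix q l assume q: "strict_mono q" and l: "((\<lambda>n. col_carleman (Kres n) t) \<circ> q) \<longlonglongrightarrow> l"
  define x where "x n = col_carleman (Kres (q n)) t" for n
  have x: "x \<longlonglongrightarrow> l" using l unfolding x_def comp_def .
  have \<tau>q: "filterlim (\<lambda>n. \<tau> (q n)) at_top sequentially"
    by (rule filterlim_compose[OF \<tau> filterlim_subseq[OF q]])
  have "x n - lam_n (q n) *\<^sub>C P (q n) (T (x n)) = P (q n) (col_carleman K t)" for n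
    using A[of "q n"] unfolding x_def col_Kres by (simp add: two_sided_inverse_def)
  moreover have "(\<lambda>n. x n - lam_n (q n) *\<^sub>C P (q n) (T (x n))) \<longlonglongrightarrow> l - lam *\<^sub>C T l"
    by (intro tendsto_diff tendsto_scaleC x bounded_ops_tendsto[OF T]
        cutoff_tendsto_diagonal \<tau>q) (use LIMSEQ_subseq_LIMSEQ[OF lam_n q] in \<open>simp add: o_def\<close>)
  moreover have "(\<lambda>n. P (q n) (col_carleman K t)) \<longlonglongrightarrow> col_carleman K t"
    by (rule cutoff_tendsto[OF \<tau>q])
  ultimately show "l - lam *\<^sub>C T l = col_carleman K t"
    using LIMSEQ_unique by simp
qed (rule solution_unique)

definition row_lim :: "real \<Rightarrow> L2" where "row_lim s = lim (\<lambda>n. row_carleman (Kres n) s)"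
definition col_lim :: "real \<Rightarrow> L2" where "col_lim t = lim (\<lambda>n. col_carleman (Kres n) t)"

text \<open>The formula of lemma \<open>resolvent_kernel_carleman\<close>, with the limit column in the place of the
  inverse applied to a column.\<close>

definition R :: "real \<Rightarrow> real \<Rightarrow> complex" where
  "R s t = K s t + lam * cinner (col_lim t) (row_carleman K s)"

lemma row_lim:
  "(\<lambda>n. row_carleman (Kres n) s) \<longlonglongrightarrow> row_lim s" "row_lim s - cnj lam *\<^sub>C adj T (row_lim s) = row_carleman K s"
  using row_limit_exists[of s] by (auto simp: row_lim_def dest: limI)

lemma col_lim:
  "(\<lambda>n. col_carleman (Kres n) t) \<longlonglongrightarrow> col_lim t" "col_lim t - lam *\<^sub>C T (col_lim t) = col_carleman K t"
  using col_limit_exists[of t] by (auto simp: col_lim_def dest: limI)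

lemma Kres_tendsto: "(\<lambda>n. Kres n s t) \<longlonglongrightarrow> R s t"
proof -
  have "(\<lambda>n. cut n s * K s t + lam_n n * cinner (col_carleman (Kres n) t) (cut n s *\<^sub>C row_carleman K s))
      \<longlonglongrightarrow> 1 * K s t + lam * cinner (col_lim t) (1 *\<^sub>C row_carleman K s)"
    by (intro tendsto_add tendsto_mult tendsto_const cut_tendsto lam_n tendsto_cinner tendsto_scaleC col_lim(1))
  then show ?thesis by (simp add: R_def scaleC_one flip: Kres_eq)
qed

text \<open>The rows of \<open>K\<close> are images of the limit rows under the adjoint of \<open>I - \<lambda> T\<close>. All the
  identities for \<open>R\<close> below come from moving this operator to the other side.\<close>

lemma cinner_row_eq: "cinner f (row_carleman K s) = cinner (f - lam *\<^sub>C T f) (row_lim s)"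
  by (simp only: row_lim(2)[symmetric] cinner_shift_adj[OF T])

lemma cinner_col_lim_row: "cinner (col_lim t) (row_carleman K s) = cinner (col_carleman K t) (row_lim s)"
  by (simp add: cinner_row_eq col_lim(2))

text \<open>The equation for the limit row, with \<open>T\<^sup>*\<close> written through its kernel, expresses its values by
  columns of \<open>K\<close>; the previous identity turns these values into those of \<open>R\<close>.\<close>

lemma rep_row_lim: "AE t in lebesgue. rep_L2 (row_lim s) t = cnj (R s t)"
proof -
  have rep: "rep_L2 (row_lim s) = rep_L2 (row_carleman K s + cnj lam *\<^sub>C adj T (row_lim s))"
    using row_lim(2)[of s] by (metis diff_add_cancel)
  show ?thesis
    using rep_L2_plus[of "row_carleman K s" "cnj lam *\<^sub>C adj T (row_lim s)"]
      rep_L2_scaleC[of "cnj lam" "adj T (row_lim s)"]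
      rep_row_carleman[OF K, of s] adj_kernel[OF K T KT, of "row_lim s"]
    by eventually_elim (simp add: rep R_def cinner_col_lim_row cinner_commute[of "row_lim s"])
qed

lemma rep_col_lim: "AE s in lebesgue. rep_L2 (col_lim t) s = R s t"
proof -
  have rep: "rep_L2 (col_lim t) = rep_L2 (col_carleman K t + lam *\<^sub>C T (col_lim t))"
    using col_lim(2)[of t] by (metis diff_add_cancel)
  show ?thesis
    using rep_L2_plus[of "col_carleman K t" "lam *\<^sub>C T (col_lim t)"]
      rep_L2_scaleC[of lam "T (col_lim t)"]
      rep_col_carleman[OF K, of t] KT[unfolded induces_iff[OF K], rule_format, of "col_lim t"]
    by eventually_elim (simp add: rep R_def)
qed

lemma borel_measurable_R:
  "R s \<in> borel_measurable lebesgue" "(\<lambda>s. R s t) \<in> borel_measurable lebesgue"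
proof -
  have "(\<lambda>t. cinner (col_carleman K t) (row_lim s)) \<in> borel_measurable lebesgue"
    by (intro borel_measurable_lebesgue_of_continuous continuous_on_cinner continuous_on_const C0_carleman K)
  then have "(\<lambda>t. K s t + lam * cinner (col_carleman K t) (row_lim s)) \<in> borel_measurable lebesgue"
    using borel_measurable_row[OF K, of s] by measurable
  then show "R s \<in> borel_measurable lebesgue"
    by (simp add: R_def[abs_def] cinner_col_lim_row)
  have "(\<lambda>s. cinner (col_lim t) (row_carleman K s)) \<in> borel_measurable lebesgue"
    by (intro borel_measurable_lebesgue_of_continuous continuous_on_cinner_row K)
  then show "(\<lambda>s. R s t) \<in> borel_measurable lebesgue"
    unfolding R_def using borel_measurable_col[OF K, of t] by measurable
qed

lemma integral_R_row: "(LINT t|lebesgue. R s t * rep_L2 g t) = cinner g (row_lim s)"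
  using cinner_eq_integralI[OF AE_I2[OF refl] rep_row_lim[of s] borel_measurable_rep_L2
      borel_measurable_cnj[OF borel_measurable_R(1)], of g]
  by (simp add: mult.commute)

lemma integral_K_rep_cong:
  assumes "AE x in lebesgue. u x = rep_L2 f x" "u \<in> borel_measurable lebesgue"
  shows "(LINT x|lebesgue. K s x * u x) = cinner f (row_carleman K s)"
  unfolding integral_row[OF K, symmetric]
proof (rule integral_cong_AE)
  show "AE x in lebesgue. K s x * u x = K s x * rep_L2 f x"
    using assms(1) by eventually_elim simp
qed (use assms(2) borel_measurable_row[OF K, of s] in measurable)

lemma integral_K_R: "(LINT x|lebesgue. K s x * R x t) = cinner (col_carleman K t) (row_lim s)"
  unfolding cinner_col_lim_row[symmetric]
  by (rule integral_K_rep_cong[OF _ borel_measurable_R(2)]) (use rep_col_lim in \<open>simp add: eq_commute\<close>)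

text \<open>The inner integral pairs a column of \<open>K\<close> with a limit row, so it is almost everywhere the
  conjugate of a value of \<open>T\<^sup>*\<close> applied to that row.\<close>

lemma iterated_integral_K_R:
  "(LINT t|lebesgue. rep_L2 g t * (LINT x|lebesgue. K s x * R x t)) = cinner g (adj T (row_lim s))"
  unfolding integral_K_R
proof -
  have "AE t in lebesgue. rep_L2 (adj T (row_lim s)) t = cnj (cinner (col_carleman K t) (row_lim s))"
    using adj_kernel[OF K T KT, of "row_lim s"] by eventually_elim (simp flip: cinner_commute)
  then have "cinner g (adj T (row_lim s)) =
      (LINT t|lebesgue. rep_L2 g t * cnj (cnj (cinner (col_carleman K t) (row_lim s))))"
    by (intro cinner_eq_integralI[OF AE_I2[OF refl] _ borel_measurable_rep_L2] borel_measurable_cnj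
        borel_measurable_lebesgue_of_continuous continuous_on_cinner continuous_on_const C0_carleman K)
  then show "(LINT t|lebesgue. rep_L2 g t * cinner (col_carleman K t) (row_lim s)) = cinner g (adj T (row_lim s))"
    by simp
qed

lemma borel_measurable_cinner_row_lim: "(\<lambda>s. cinner g (row_lim s)) \<in> borel_measurable lebesgue"
proof (rule borel_measurable_LIMSEQ_metric)
  show "(\<lambda>n. cinner g (row_carleman (Kres n) s)) \<longlonglongrightarrow> cinner g (row_lim s)" for s
    by (intro tendsto_cinner tendsto_const row_lim(1))
  show "(\<lambda>s. cinner g (row_carleman (Kres n) s)) \<in> borel_measurable lebesgue" for n
    by (intro borel_measurable_lebesgue_of_continuous continuous_on_cinner continuous_on_const continuous_row_Kres)
qed

section \<open>Solvability of the integral equation\<close>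

lemma resolvent_of_solution:
  assumes f: "f - lam *\<^sub>C T f = g"
  shows "AE s in lebesgue. rep_L2 (T f) s = cinner g (row_lim s)"
  using KT[unfolded induces_iff[OF K], rule_format, of f] by (simp add: cinner_row_eq f)

lemma solution_formula:
  assumes f: "f - lam *\<^sub>C T f = g"
  shows "AE s in lebesgue. rep_L2 f s = rep_L2 g s + lam * cinner g (row_lim s)"
proof -
  have rep: "rep_L2 f = rep_L2 (g + lam *\<^sub>C T f)"
    using f by (metis diff_add_cancel)
  show ?thesis
    using rep_L2_plus[of g "lam *\<^sub>C T f"] rep_L2_scaleC[of lam "T f"] resolvent_of_solution[OF f]
    by eventually_elim (simp add: rep)
qed

text \<open>If \<open>f\<close> solves the equation, then \<open>s \<mapsto> \<langle>g, row_lim s\<rangle>\<close> represents \<open>T f\<close>, and the second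
  condition is the identity \<open>(I - \<lambda> T) T f = T g\<close> paired with \<open>row_lim s\<close>. Conversely, when this function
  is square integrable, with class \<open>H\<close>, the second condition says that \<open>H = T g + \<lambda> T H\<close>, which is exactly
  what makes \<open>g + \<lambda> H\<close> a solution.\<close>

lemma solvable_iff:
  "(\<exists>f. f - lam *\<^sub>C T f = g) \<longleftrightarrow>
     square_integrable (\<lambda>s. cinner g (row_lim s)) \<and>
     (\<forall>s. (LINT x|lebesgue. K s x * cinner g (row_lim x)) = cinner g (adj T (row_lim s)))"
  (is "_ \<longleftrightarrow> ?sq \<and> ?commutes")
proof
  assume "\<exists>f. f - lam *\<^sub>C T f = g"
  then obtain f where f: "f - lam *\<^sub>C T f = g" by blast
  note h = resolvent_of_solution[OF f]
  have ?sq
    using square_integrable_cong_AE[OF square_integrable_rep_L2 h borel_measurable_cinner_row_lim] .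
  moreover have ?commutes
  proof
    fix s
    have "(LINT x|lebesgue. K s x * cinner g (row_lim x)) = cinner (T f) (row_carleman K s)"
      by (rule integral_K_rep_cong[OF _ borel_measurable_cinner_row_lim]) (use h in \<open>simp add: eq_commute\<close>)
    also have "\<dots> = cinner (T f - lam *\<^sub>C T (T f)) (row_lim s)" by (rule cinner_row_eq)
    also have "T f - lam *\<^sub>C T (T f) = T g"
      by (simp add: f[symmetric] bounded_ops_diff[OF T] bounded_ops_scaleC[OF T])
    finally show "(LINT x|lebesgue. K s x * cinner g (row_lim x)) = cinner g (adj T (row_lim s))"
      by (simp add: cinner_adj[OF T])
  qed
  ultimately show "?sq \<and> ?commutes" ..
next
  assume asm: "?sq \<and> ?commutes"
  define H where "H = abs_L2 (\<lambda>s. cinner g (row_lim s))"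
  have H: "AE s in lebesgue. rep_L2 H s = cinner g (row_lim s)"
    unfolding H_def using asm by (intro rep_abs_L2) simp
  have HT: "cinner H (row_carleman K s) = cinner g (adj T (row_lim s))" for s
    using asm integral_K_rep_cong[OF _ borel_measurable_cinner_row_lim, of g H s] H
    by (simp add: eq_commute)
  have "H = T g + lam *\<^sub>C T H"
  proof (rule L2_eqI)
    have "cinner g (row_lim s) = cinner g (row_carleman K s) + lam * cinner g (adj T (row_lim s))" for s
      by (simp add: row_lim(2)[symmetric] cinner_diff_right cinner_scaleC_right)
    then show "AE s in lebesgue. rep_L2 H s = rep_L2 (T g + lam *\<^sub>C T H) s"
      using H rep_L2_plus[of "T g" "lam *\<^sub>C T H"] rep_L2_scaleC[of lam "T H"]
        KT[unfolded induces_iff[OF K], rule_format, of g] KT[unfolded induces_iff[OF K], rule_format, of H]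
      by (auto elim!: eventually_rev_mp simp: HT)
  qed
  then have "T g + lam *\<^sub>C T H = H" by simp
  moreover have "(g + lam *\<^sub>C H) - lam *\<^sub>C T (g + lam *\<^sub>C H) = g + lam *\<^sub>C H - lam *\<^sub>C (T g + lam *\<^sub>C T H)"
    by (simp add: bounded_ops_add[OF T] bounded_ops_scaleC[OF T])
  ultimately have "(g + lam *\<^sub>C H) - lam *\<^sub>C T (g + lam *\<^sub>C H) = g" by simp
  then show "\<exists>f. f - lam *\<^sub>C T f = g" by blast
qed

end

lemma second_kind_solution_iff:
  assumes K: "K0_kernel K" and KT: "induces K T"
  shows "second_kind_solution K z g f \<longleftrightarrow> f - z *\<^sub>C T f = g"
proof -
  have "AE s in lebesgue. rep_L2 (f - z *\<^sub>C T f) s = rep_L2 f s - z * (LINT t|lebesgue. K s t * rep_L2 f t)"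
    using rep_L2_minus[of f "z *\<^sub>C T f"] rep_L2_scaleC[of z "T f"] KT[unfolded induces_def, rule_format, of f]
    by eventually_elim simp
  then show ?thesis
    unfolding second_kind_solution_def L2_eq_iff
    by (intro iffI) (auto elim: eventually_elim2)
qed

theorem theorem4:
  fixes K :: "real \<Rightarrow> real \<Rightarrow> complex"
    and T :: "L2 \<Rightarrow> L2"
    and \<tau> :: "nat \<Rightarrow> real"
    and Tn :: "nat \<Rightarrow> L2 \<Rightarrow> L2"
    and lam_n :: "nat \<Rightarrow> complex"
    and lam :: complex
    and Kres :: "nat \<Rightarrow> real \<Rightarrow> real \<Rightarrow> complex"
  assumes "K0_kernel K" and "T \<in> bounded_ops" and "induces K T"
    and "\<And>n. \<tau> n > 0" and "strict_mono \<tau>" and "filterlim \<tau> at_top sequentially"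
    and Tn: "\<And>n. Tn n = cutoff (\<tau> n) \<circ> T"
    and "\<And>n. K0_kernel (\<lambda>s t. indicator {-\<tau> n<..<\<tau> n} s * K s t)"
    and "\<And>n. K0_kernel (\<lambda>s t. indicator {-\<tau> n<..<\<tau> n} s * K s t * indicator {-\<tau> n<..<\<tau> n} t)"
    and "\<And>n. nuclear (Tn n)"
    and "\<And>n. nuclear (Tn n \<circ> cutoff (\<tau> n))"
    and "\<And>n. lam_n n \<in> regular_values (Tn n)"
    and "lam_n \<longlonglongrightarrow> lam" and "lam \<noteq> 0"
    and Kres: "\<And>n. Kres n = resolvent_kernel (Tn n) (lam_n n)"
  shows
    "((\<forall>s. relatively_compact_seq (\<lambda>n. row_carleman (Kres n) s)) \<longrightarrow>
        lam \<notin> point_characteristic_set T) \<and>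
     ((\<forall>t. relatively_compact_seq (\<lambda>n. col_carleman (Kres n) t)) \<longrightarrow>
        lam \<notin> residual_characteristic_set T) \<and>
     ((\<forall>s. relatively_compact_seq (\<lambda>n. row_carleman (Kres n) s)) \<and>
      (\<forall>t. relatively_compact_seq (\<lambda>n. col_carleman (Kres n) t)) \<longrightarrow>
        (\<exists>R. (\<forall>s t. (\<lambda>n. Kres n s t) \<longlonglongrightarrow> R s t) \<and>
          (\<forall>g.
            ((\<exists>f. second_kind_solution K lam g f) \<longleftrightarrow>
              (\<integral>\<^sup>+s. ennreal ((cmod (LINT t|lebesgue. R s t * rep_L2 g t))\<^sup>2) \<partial>lebesgue) < \<infinity> \<and>
              (\<forall>s. (LINT x|lebesgue. K s x * (LINT t|lebesgue. R x t * rep_L2 g t)) =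
                   (LINT t|lebesgue. rep_L2 g t * (LINT x|lebesgue. K s x * R x t)))) \<and>
            ((\<exists>f. second_kind_solution K lam g f) \<longrightarrow>
              (\<exists>!f. second_kind_solution K lam g f) \<and>
              (\<forall>f. second_kind_solution K lam g f \<longrightarrow>
                (AE s in lebesgue. rep_L2 f s =
                   rep_L2 g s + lam * (LINT t|lebesgue. R s t * rep_L2 g t)))))))"
proof -
  have "\<exists>A. \<forall>n. two_sided_inverse (Tn n) (lam_n n) (A n)"
    using assms(12) unfolding regular_values_iff by metis
  then obtain A where A: "\<And>n. two_sided_inverse (Tn n) (lam_n n) (A n)" by blast
  interpret tr: truncated_resolvents K T \<tau> lam_n lam A
    by unfold_locales (use assms(1-3,6,8,13) A in \<open>auto simp: Tn\<close>)
  have Kres_eq: "Kres n = tr.Kres n" for n by (simp add: Kres Tn)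
  let ?rows = "\<forall>s. relatively_compact_seq (\<lambda>n. row_carleman (Kres n) s)"
  let ?cols = "\<forall>t. relatively_compact_seq (\<lambda>n. col_carleman (Kres n) t)"
  have no_point: "lam \<notin> point_characteristic_set T" if ?rows
    by (rule tr.not_point_characteristic[OF relatively_compact_seq_bounded]) (use that in \<open>simp add: Kres_eq\<close>)
  have no_residual: "lam \<notin> residual_characteristic_set T" if ?cols
    by (rule tr.not_residual_characteristic[OF relatively_compact_seq_bounded]) (use that in \<open>simp add: Kres_eq\<close>)
  show ?thesis
  proof (intro conjI impI, goal_cases)
    case 1 then show ?case by (rule no_point)
  next
    case 2 then show ?case by (rule no_residual)
  next
    case 3
    interpret ctr: compact_truncated_resolvents K T \<tau> lam_n lam A
      by unfold_locales (use 3 in \<open>simp_all add: Kres_eq\<close>)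
    have sq: "square_integrable (\<lambda>s. cinner g (ctr.row_lim s)) \<longleftrightarrow>
        (\<integral>\<^sup>+s. ennreal ((cmod (cinner g (ctr.row_lim s)))\<^sup>2) \<partial>lebesgue) < \<infinity>" for g
      by (rule square_integrable_iff_nn_integral[OF ctr.borel_measurable_cinner_row_lim])
    show ?case
    proof (intro exI[of _ ctr.R] conjI allI)
      show "(\<lambda>n. Kres n s t) \<longlonglongrightarrow> ctr.R s t" for s t
        using ctr.Kres_tendsto by (simp add: Kres_eq)
    next
      fix g
      show "(\<exists>f. second_kind_solution K lam g f) \<longleftrightarrow>
          (\<integral>\<^sup>+s. ennreal ((cmod (LINT t|lebesgue. ctr.R s t * rep_L2 g t))\<^sup>2) \<partial>lebesgue) < \<infinity> \<and>
          (\<forall>s. (LINT x|lebesgue. K s x * (LINT t|lebesgue. ctr.R x t * rep_L2 g t)) =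
               (LINT t|lebesgue. rep_L2 g t * (LINT x|lebesgue. K s x * ctr.R x t)))"
        unfolding second_kind_solution_iff[OF tr.K tr.KT] ctr.integral_R_row ctr.iterated_integral_K_R
          ctr.solvable_iff sq ..
      show "(\<exists>f. second_kind_solution K lam g f) \<longrightarrow>
          (\<exists>!f. second_kind_solution K lam g f) \<and>
          (\<forall>f. second_kind_solution K lam g f \<longrightarrow>
            (AE s in lebesgue. rep_L2 f s = rep_L2 g s + lam * (LINT t|lebesgue. ctr.R s t * rep_L2 g t)))"
        unfolding second_kind_solution_iff[OF tr.K tr.KT] ctr.integral_R_row
        using ctr.solution_unique ctr.solution_formula by blast
    qed
  qed
qed

end
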